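(* Let $I\subset K[x_1,\ldots,x_n]$ be a graded ideal. There exists a non-empty Zariski-open subset $U\subset \mathrm{GL}_n(K)$ such that for every $g\in U$ there is a universal Gröbner basis $\mathcal{G}(g)=\{h_1(g),\ldots,h_s(g)\}$ of $g(I)$, and all these universal Gröbner bases $\mathcal{G}(g)$, $g\in U$, have the same support.
   Context: $K$ is an algebraically closed field of characteristic $0$. Each $g=(g_{ij})\in\mathrm{GL}_n(K)$ is identified with the $K$-algebra automorphism of $K[x_1,\ldots,x_n]$ given by $x_i\mapsto \sum_{j=1}^n g_{ij}x_j$, and $g(I)$ denotes the image of $I$. $\mathrm{GL}_n(K)$ carries the Zariski topology induced from $K^{n\times n}$. A universal Gröbner basis of $I$ is a finite generating set of $I$ that is a Gröbner basis of $I$ with respect to every term order. The support of a polynomial is the set of its exponent vectors (of terms with nonzero coefficient); the support of a finite set of polynomials is the set of the supports of its elements. *)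

theory Defs
  imports "HOL-Library.Poly_Mapping" "HOL-Computational_Algebra.Polynomial" "Jordan_Normal_Form.Matrix"
begin

text \<open>Multivariate polynomials: a monomial is an exponent vector of type nat =>0 nat
  (variable x_i is index i, i < n); a polynomial maps monomials to coefficients (finite support).
  Multiplication on this type is the usual polynomial product.\<close>

type_synonym 'a mpoly = "(nat \<Rightarrow>\<^sub>0 nat) \<Rightarrow>\<^sub>0 'a"

definition monoms :: "nat \<Rightarrow> (nat \<Rightarrow>\<^sub>0 nat) set" where
  "monoms n = {m. Poly_Mapping.keys m \<subseteq> {..<n}}"

definition polys :: "nat \<Rightarrow> 'a::comm_ring_1 mpoly set" where
  "polys n = {p. Poly_Mapping.keys p \<subseteq> monoms n}"

definition tdeg :: "(nat \<Rightarrow>\<^sub>0 nat) \<Rightarrow> nat" where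
  "tdeg m = (\<Sum>i\<in>Poly_Mapping.keys m. Poly_Mapping.lookup m i)"

definition hcomp :: "nat \<Rightarrow> 'a::comm_ring_1 mpoly \<Rightarrow> 'a mpoly" where
  "hcomp d f = Abs_poly_mapping (\<lambda>m. if tdeg m = d then Poly_Mapping.lookup f m else 0)"

definition is_ideal :: "nat \<Rightarrow> 'a::comm_ring_1 mpoly set \<Rightarrow> bool" where
  "is_ideal n I \<longleftrightarrow> I \<subseteq> polys n \<and> 0 \<in> I \<and> (\<forall>f\<in>I. \<forall>h\<in>I. f + h \<in> I)
      \<and> (\<forall>f\<in>I. \<forall>q\<in>polys n. q * f \<in> I)"

definition graded_ideal :: "nat \<Rightarrow> 'a::comm_ring_1 mpoly set \<Rightarrow> bool" where
  "graded_ideal n I \<longleftrightarrow> is_ideal n I \<and> (\<forall>f\<in>I. \<forall>d. hcomp d f \<in> I)"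

definition ideal_gen :: "nat \<Rightarrow> 'a::comm_ring_1 mpoly set \<Rightarrow> 'a mpoly set" where
  "ideal_gen n G = {f. \<exists>c. (\<forall>h\<in>G. c h \<in> polys n) \<and> f = (\<Sum>h\<in>G. c h * h)}"

definition subst :: "(nat \<Rightarrow> 'a::comm_ring_1 mpoly) \<Rightarrow> 'a mpoly \<Rightarrow> 'a mpoly" where
  "subst \<sigma> f = (\<Sum>m\<in>Poly_Mapping.keys f. Poly_Mapping.single 0 (Poly_Mapping.lookup f m) * (\<Prod>i\<in>Poly_Mapping.keys m. \<sigma> i ^ Poly_Mapping.lookup m i))"

definition lin_form :: "nat \<Rightarrow> 'a::comm_ring_1 mat \<Rightarrow> nat \<Rightarrow> 'a mpoly" where
  "lin_form n g i = (\<Sum>j<n. Poly_Mapping.single (Poly_Mapping.single j 1) (g $$ (i, j)))"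

definition act :: "nat \<Rightarrow> 'a::comm_ring_1 mat \<Rightarrow> 'a mpoly set \<Rightarrow> 'a mpoly set" where
  "act n g I = subst (lin_form n g) ` I"

definition GL :: "nat \<Rightarrow> 'a::comm_ring_1 mat set" where
  "GL n = {g \<in> carrier_mat n n. invertible_mat g}"

definition eval_entries :: "'a::comm_ring_1 mat \<Rightarrow> (((nat \<times> nat) \<Rightarrow>\<^sub>0 nat) \<Rightarrow>\<^sub>0 'a) \<Rightarrow> 'a" where
  "eval_entries g p = (\<Sum>m\<in>Poly_Mapping.keys p. Poly_Mapping.lookup p m * (\<Prod>ij\<in>Poly_Mapping.keys m. (g $$ ij) ^ Poly_Mapping.lookup m ij))"

definition zariski_open_GL :: "nat \<Rightarrow> 'a::comm_ring_1 mat set \<Rightarrow> bool" where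
  "zariski_open_GL n U \<longleftrightarrow> U \<subseteq> GL n \<and>
     (\<exists>S. (\<forall>p\<in>S. \<forall>m\<in>Poly_Mapping.keys p. Poly_Mapping.keys m \<subseteq> {..<n} \<times> {..<n}) \<and>
          U = {g \<in> GL n. \<exists>p\<in>S. eval_entries g p \<noteq> 0})"

definition term_order :: "nat \<Rightarrow> ((nat \<Rightarrow>\<^sub>0 nat) \<Rightarrow> (nat \<Rightarrow>\<^sub>0 nat) \<Rightarrow> bool) \<Rightarrow> bool" where
  "term_order n lt \<longleftrightarrow>
     (\<forall>a\<in>monoms n. \<not> lt a a) \<and>
     (\<forall>a\<in>monoms n. \<forall>b\<in>monoms n. \<forall>c\<in>monoms n. lt a b \<longrightarrow> lt b c \<longrightarrow> lt a c) \<and>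
     (\<forall>a\<in>monoms n. \<forall>b\<in>monoms n. a \<noteq> b \<longrightarrow> lt a b \<or> lt b a) \<and>
     (\<forall>a\<in>monoms n. a \<noteq> 0 \<longrightarrow> lt 0 a) \<and>
     (\<forall>a\<in>monoms n. \<forall>b\<in>monoms n. \<forall>c\<in>monoms n. lt a b \<longrightarrow> lt (a + c) (b + c))"

definition lead_monom :: "((nat \<Rightarrow>\<^sub>0 nat) \<Rightarrow> (nat \<Rightarrow>\<^sub>0 nat) \<Rightarrow> bool) \<Rightarrow> 'a::zero mpoly \<Rightarrow> nat \<Rightarrow>\<^sub>0 nat" where
  "lead_monom lt f = (THE m. m \<in> Poly_Mapping.keys f \<and> (\<forall>m'\<in>Poly_Mapping.keys f. m' \<noteq> m \<longrightarrow> lt m' m))"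

text \<open>Groebner basis: finite G \<subseteq> I such that the leading monomial of every nonzero f in I
  is divisible by the leading monomial of some nonzero element of G
  (equivalently, in(I) is generated by the leading terms of G).\<close>
definition groebner_basis :: "nat \<Rightarrow> ((nat \<Rightarrow>\<^sub>0 nat) \<Rightarrow> (nat \<Rightarrow>\<^sub>0 nat) \<Rightarrow> bool) \<Rightarrow>
    'a::comm_ring_1 mpoly set \<Rightarrow> 'a mpoly set \<Rightarrow> bool" where
  "groebner_basis n lt I G \<longleftrightarrow> finite G \<and> G \<subseteq> I \<and>
     (\<forall>f\<in>I. f \<noteq> 0 \<longrightarrow> (\<exists>h\<in>G. h \<noteq> 0 \<and> (\<exists>c. lead_monom lt f = lead_monom lt h + c)))"

definition universal_groebner_basis :: "nat \<Rightarrow> 'a::comm_ring_1 mpoly set \<Rightarrow> 'a mpoly set \<Rightarrow> bool" where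
  "universal_groebner_basis n I G \<longleftrightarrow> finite G \<and> ideal_gen n G = I \<and>
     (\<forall>lt. term_order n lt \<longrightarrow> groebner_basis n lt I G)"

definition supp :: "'a::zero mpoly \<Rightarrow> (nat \<Rightarrow>\<^sub>0 nat) set" where
  "supp f = Poly_Mapping.keys f"

definition supp_set :: "'a::zero mpoly set \<Rightarrow> (nat \<Rightarrow>\<^sub>0 nat) set set" where
  "supp_set G = supp ` G"

end

theory Submission
  imports Defs "Jordan_Normal_Form.Determinant"
begin

text \<open>All coordinate changes \<open>J = g(I)\<close> have the same Hilbert function, so the leading monomial
  ideals of \<open>J\<close>, for all \<open>g\<close> and all term orders at once, are generated in degrees at most
  some common \<open>D\<close>.
  Choose one element of \<open>J\<close> for each circuit, that is, each minimal support of a nonzero element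
  of \<open>J\<close>, within the monomials of degree at most \<open>D\<close>. Every leading monomial of degree at most
  \<open>D\<close> is the leading monomial of a circuit, so these finitely many elements are a universal
  Groebner basis. Whether \<open>J\<close> has a nonzero element supported in a given set of monomials is a
  rank condition on coefficients polynomial in the entries of \<open>g\<close>, so the set of circuits of
  degree at most \<open>D\<close> is constant on a nonempty Zariski-open set.\<close>

section \<open>Evaluation of polynomials\<close>

text \<open>A leading monomial depends only on the support and the order. So a circuit inside the
  support of \<open>f\<close> that contains the leading monomial of \<open>f\<close> leads with the
  same monomial, and circuits themselves mention no order; this makes one choice serve all orders at
  once. Elimination between elements of the ideal produces such a circuit.

  The bound \<open>D\<close> must be fixed before \<open>g\<close> and the order are, because an
  open set can control only finitely many sets of monomials. The Hilbert function is the invariant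
  that achieves this: invertible linear substitutions preserve the dimension in each degree, and so
  does passing to leading monomials.

  Openness is one-sided. Only the absence of nonzero elements supported in \<open>C\<close> spreads
  from one \<open>g0\<close> to an open set. If it occurs for no \<open>g0\<close>, then
  \<open>C\<close> is supported for all \<open>g\<close>, so one polynomial in the entries settles
  each \<open>C\<close>. The product of these polynomials and the determinant is not identically
  zero over an infinite field.\<close>

definition mono_eval :: "('x \<Rightarrow> 'b::comm_ring_1) \<Rightarrow> ('x \<Rightarrow>\<^sub>0 nat) \<Rightarrow> 'b" where
  "mono_eval \<sigma> m = (\<Prod>i\<in>Poly_Mapping.keys m. \<sigma> i ^ Poly_Mapping.lookup m i)"

text \<open>One evaluation map covers two substitutions: \<open>subst\<close> embeds the
  coefficients as constants, \<open>eval_entries\<close> keeps them as scalars. The homomorphism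
  laws are then proved once.\<close>

definition poly_eval ::
  "('a::comm_ring_1 \<Rightarrow> 'b::comm_ring_1) \<Rightarrow> ('x \<Rightarrow> 'b) \<Rightarrow> (('x \<Rightarrow>\<^sub>0 nat) \<Rightarrow>\<^sub>0 'a) \<Rightarrow> 'b" where
  "poly_eval \<phi> \<sigma> f = (\<Sum>m\<in>Poly_Mapping.keys f. \<phi> (Poly_Mapping.lookup f m) * mono_eval \<sigma> m)"

lemma mono_eval_superset:
  assumes "finite A" "Poly_Mapping.keys m \<subseteq> A"
  shows "mono_eval \<sigma> m = (\<Prod>i\<in>A. \<sigma> i ^ Poly_Mapping.lookup m i)"
  unfolding mono_eval_def using assms
  by (intro prod.mono_neutral_left) (auto simp: in_keys_iff)

lemma mono_eval_0 [simp]: "mono_eval \<sigma> 0 = 1"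
  by (simp add: mono_eval_def)

lemma mono_eval_single [simp]: "mono_eval \<sigma> (Poly_Mapping.single i k) = \<sigma> i ^ k"
  by (simp add: mono_eval_def)

lemma mono_eval_add: "mono_eval \<sigma> (m + m') = mono_eval \<sigma> m * mono_eval \<sigma> m'"
proof -
  let ?A = "Poly_Mapping.keys m \<union> Poly_Mapping.keys m'"
  have "Poly_Mapping.keys (m + m') \<subseteq> ?A"
    by (rule Poly_Mapping.keys_add)
  then show ?thesis
    by (simp add: mono_eval_superset[of ?A] lookup_add power_add prod.distrib)
qed

lemma sum_monomials:
  assumes "finite A" "Poly_Mapping.keys f \<subseteq> A"
  shows "f = (\<Sum>m\<in>A. Poly_Mapping.single m (Poly_Mapping.lookup f m))"
proof (rule poly_mapping_eqI)
  fix k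
  have "(\<Sum>m\<in>A. Poly_Mapping.lookup f m when m = k) = Poly_Mapping.lookup f k"
    using assms by (cases "k \<in> A") (auto simp: in_keys_iff when_def)
  then show "Poly_Mapping.lookup f k =
    Poly_Mapping.lookup (\<Sum>m\<in>A. Poly_Mapping.single m (Poly_Mapping.lookup f m)) k"
    by (simp add: lookup_sum lookup_single)
qed

locale coeff_hom =
  fixes \<phi> :: "'a::comm_ring_1 \<Rightarrow> 'b::comm_ring_1"
  assumes hom_add: "\<phi> (a + b) = \<phi> a + \<phi> b"
    and hom_mult: "\<phi> (a * b) = \<phi> a * \<phi> b"
    and hom_one: "\<phi> 1 = 1"
begin

lemma hom_zero: "\<phi> 0 = 0"
  using hom_add[of 0 0] by simp

lemma eval_zero: "poly_eval \<phi> \<sigma> 0 = 0"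
  by (simp add: poly_eval_def)

lemma eval_add: "poly_eval \<phi> \<sigma> (f + h) = poly_eval \<phi> \<sigma> f + poly_eval \<phi> \<sigma> h"
  unfolding poly_eval_def
  by (rule setsum_keys_plus_distrib) (auto simp: hom_zero hom_add algebra_simps)

lemma eval_sum: "poly_eval \<phi> \<sigma> (\<Sum>x\<in>A. F x) = (\<Sum>x\<in>A. poly_eval \<phi> \<sigma> (F x))"
  by (induction A rule: infinite_finite_induct) (auto simp: eval_zero eval_add)

lemma eval_single: "poly_eval \<phi> \<sigma> (Poly_Mapping.single m c) = \<phi> c * mono_eval \<sigma> m"
  by (auto simp: poly_eval_def hom_zero)

lemma eval_one: "poly_eval \<phi> \<sigma> 1 = 1"
  using eval_single[of \<sigma> 0 1] by (simp add: hom_one)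

lemma eval_mult: "poly_eval \<phi> \<sigma> (f * h) = poly_eval \<phi> \<sigma> f * poly_eval \<phi> \<sigma> h"
proof -
  let ?s = "\<lambda>f m. Poly_Mapping.single m (Poly_Mapping.lookup f m)"
  have f: "f = (\<Sum>a\<in>Poly_Mapping.keys f. ?s f a)" for f :: "('c \<Rightarrow>\<^sub>0 nat) \<Rightarrow>\<^sub>0 'a"
    by (rule sum_monomials) auto
  have "f * h = (\<Sum>a\<in>Poly_Mapping.keys f. ?s f a) * (\<Sum>b\<in>Poly_Mapping.keys h. ?s h b)"
    using f[of f] f[of h] by simp
  also have "\<dots> = (\<Sum>a\<in>Poly_Mapping.keys f. \<Sum>b\<in>Poly_Mapping.keys h.
      Poly_Mapping.single (a + b) (Poly_Mapping.lookup f a * Poly_Mapping.lookup h b))"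
    by (simp add: sum_product mult_single)
  finally have "poly_eval \<phi> \<sigma> (f * h) = (\<Sum>a\<in>Poly_Mapping.keys f. \<Sum>b\<in>Poly_Mapping.keys h.
      \<phi> (Poly_Mapping.lookup f a * Poly_Mapping.lookup h b) * mono_eval \<sigma> (a + b))"
    by (simp only: eval_sum eval_single)
  then show ?thesis
    by (simp add: hom_mult mono_eval_add poly_eval_def sum_product algebra_simps)
qed

lemma eval_power: "poly_eval \<phi> \<sigma> (f ^ k) = poly_eval \<phi> \<sigma> f ^ k"
  by (induction k) (auto simp: eval_one eval_mult)

lemma eval_prod: "poly_eval \<phi> \<sigma> (\<Prod>x\<in>A. F x) = (\<Prod>x\<in>A. poly_eval \<phi> \<sigma> (F x))"
  by (induction A rule: infinite_finite_induct) (auto simp: eval_one eval_mult)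

end

section \<open>Substitution and evaluation at matrix entries as homomorphisms\<close>

abbreviation const :: "'a::comm_ring_1 \<Rightarrow> ('b::comm_monoid_add \<Rightarrow>\<^sub>0 'a)" where
  "const \<equiv> Poly_Mapping.single 0"

interpretation const: coeff_hom "const :: 'a::comm_ring_1 \<Rightarrow> ('b::comm_monoid_add \<Rightarrow>\<^sub>0 'a)"
  by unfold_locales (auto simp: single_add mult_single)

interpretation ident: coeff_hom "\<lambda>c :: 'a::comm_ring_1. c"
  by unfold_locales auto

lemma subst_eq_poly_eval: "subst \<sigma> = poly_eval const \<sigma>"
  by (simp add: fun_eq_iff subst_def poly_eval_def mono_eval_def)

lemma eval_entries_eq_poly_eval: "eval_entries g = poly_eval (\<lambda>c. c) (\<lambda>ij. g $$ ij)"
  by (simp add: fun_eq_iff eval_entries_def poly_eval_def mono_eval_def)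

lemma subst_zero: "subst \<sigma> 0 = 0"
  by (simp add: subst_eq_poly_eval const.eval_zero)

lemma subst_add: "subst \<sigma> (f + h) = subst \<sigma> f + subst \<sigma> h"
  by (simp add: subst_eq_poly_eval const.eval_add)

lemma subst_sum: "subst \<sigma> (\<Sum>x\<in>A. F x) = (\<Sum>x\<in>A. subst \<sigma> (F x))"
  by (simp add: subst_eq_poly_eval const.eval_sum)

lemma subst_mult: "subst \<sigma> (f * h) = subst \<sigma> f * subst \<sigma> h"
  by (simp add: subst_eq_poly_eval const.eval_mult)

lemma subst_power: "subst \<sigma> (f ^ k) = subst \<sigma> f ^ k"
  by (simp add: subst_eq_poly_eval const.eval_power)

lemma subst_prod: "subst \<sigma> (\<Prod>x\<in>A. F x) = (\<Prod>x\<in>A. subst \<sigma> (F x))"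
  by (simp add: subst_eq_poly_eval const.eval_prod)

lemma subst_single: "subst \<sigma> (Poly_Mapping.single m c) = const c * mono_eval \<sigma> m"
  by (simp add: subst_eq_poly_eval const.eval_single)

lemma subst_const: "subst \<sigma> (const c) = const c"
  by (simp add: subst_single)

lemma subst_subst: "subst \<sigma> (subst \<tau> f) = subst (\<lambda>i. subst \<sigma> (\<tau> i)) f"
  unfolding subst_def[of \<tau>] subst_def[of "\<lambda>i. subst \<sigma> (\<tau> i)"]
  by (simp add: subst_sum subst_mult subst_const subst_prod subst_power)

lemma lookup_const_mult [simp]:
  "Poly_Mapping.lookup (const c * f) m = c * Poly_Mapping.lookup f m"
proof -
  have "const c * f = const c * (\<Sum>a\<in>Poly_Mapping.keys f. Poly_Mapping.single a (Poly_Mapping.lookup f a))"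
    using sum_monomials[of "Poly_Mapping.keys f" f] by simp
  also have "\<dots> = (\<Sum>a\<in>Poly_Mapping.keys f. Poly_Mapping.single a (c * Poly_Mapping.lookup f a))"
    by (simp add: sum_distrib_left mult_single)
  also have "Poly_Mapping.lookup \<dots> m = c * Poly_Mapping.lookup f m"
    by (auto simp: lookup_sum lookup_single when_def in_keys_iff)
  finally show ?thesis .
qed

lemma lookup_single_mult:
  fixes f :: "'b::cancel_comm_monoid_add \<Rightarrow>\<^sub>0 'a::comm_ring_1"
  shows "Poly_Mapping.lookup (Poly_Mapping.single a c * f) (a + m) = c * Poly_Mapping.lookup f m"
proof -
  have "Poly_Mapping.single a c * f =
      Poly_Mapping.single a c * (\<Sum>b\<in>Poly_Mapping.keys f. Poly_Mapping.single b (Poly_Mapping.lookup f b))"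
    using sum_monomials[of "Poly_Mapping.keys f" f] by simp
  also have "\<dots> = (\<Sum>b\<in>Poly_Mapping.keys f. Poly_Mapping.single (a + b) (c * Poly_Mapping.lookup f b))"
    by (simp add: sum_distrib_left mult_single)
  also have "Poly_Mapping.lookup \<dots> (a + m) = c * Poly_Mapping.lookup f m"
    by (auto simp: lookup_sum lookup_single when_def in_keys_iff)
  finally show ?thesis .
qed

text \<open>Exponent addition is cancellative, so distinct terms stay distinct, and in a domain no
  coefficient is killed.\<close>

lemma keys_single_mult:
  fixes f :: "'b::cancel_comm_monoid_add \<Rightarrow>\<^sub>0 'a::idom"
  assumes "c \<noteq> 0"
  shows "Poly_Mapping.keys (Poly_Mapping.single a c * f) = (+) a ` Poly_Mapping.keys f"
proof
  show "Poly_Mapping.keys (Poly_Mapping.single a c * f) \<subseteq> (+) a ` Poly_Mapping.keys f"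
    using keys_mult[of "Poly_Mapping.single a c" f] assms by auto
  show "(+) a ` Poly_Mapping.keys f \<subseteq> Poly_Mapping.keys (Poly_Mapping.single a c * f)"
    using assms by (auto simp: in_keys_iff lookup_single_mult)
qed

section \<open>Monomials and degrees\<close>

lemma monoms_0 [simp]: "0 \<in> monoms n"
  by (simp add: monoms_def)

lemma monoms_add: "a \<in> monoms n \<Longrightarrow> b \<in> monoms n \<Longrightarrow> a + b \<in> monoms n"
  using Poly_Mapping.keys_add[of a b] by (auto simp: monoms_def)

lemma monoms_add_iff: "a + b \<in> monoms n \<longleftrightarrow> a \<in> monoms n \<and> b \<in> monoms n"
  for a b :: "nat \<Rightarrow>\<^sub>0 nat"
  by (auto simp: monoms_def in_keys_iff lookup_add subset_iff)

lemma tdeg_eq_sum: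
  assumes "finite A" "Poly_Mapping.keys m \<subseteq> A"
  shows "tdeg m = (\<Sum>i\<in>A. Poly_Mapping.lookup m i)"
  unfolding tdeg_def using assms by (intro sum.mono_neutral_left) (auto simp: in_keys_iff)

lemma tdeg_add: "tdeg (a + b) = tdeg a + tdeg b"
proof -
  let ?A = "Poly_Mapping.keys a \<union> Poly_Mapping.keys b"
  have "Poly_Mapping.keys (a + b) \<subseteq> ?A"
    by (rule Poly_Mapping.keys_add)
  then show ?thesis
    by (simp add: tdeg_eq_sum[of ?A] lookup_add sum.distrib)
qed

lemma tdeg_0 [simp]: "tdeg 0 = 0"
  by (simp add: tdeg_def)

lemma tdeg_single [simp]: "tdeg (Poly_Mapping.single i k) = k"
  by (simp add: tdeg_def)

lemma lookup_le_tdeg: "Poly_Mapping.lookup m i \<le> tdeg m"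
proof (cases "i \<in> Poly_Mapping.keys m")
  case True
  then show ?thesis
    unfolding tdeg_def by (intro member_le_sum) auto
qed (simp add: in_keys_iff)

definition monoms_deg :: "nat \<Rightarrow> nat \<Rightarrow> (nat \<Rightarrow>\<^sub>0 nat) set" where
  "monoms_deg n d = {m \<in> monoms n. tdeg m = d}"

definition monoms_upto :: "nat \<Rightarrow> nat \<Rightarrow> (nat \<Rightarrow>\<^sub>0 nat) set" where
  "monoms_upto n d = {m \<in> monoms n. tdeg m \<le> d}"

lemma finite_monoms_upto [simp]: "finite (monoms_upto n d)"
proof (rule finite_imageD)
  show "inj_on Poly_Mapping.lookup (monoms_upto n d)"
    by (auto intro!: inj_onI poly_mapping_eqI)
  have "Poly_Mapping.lookup m i \<le> d" if "m \<in> monoms_upto n d" for m i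
    using lookup_le_tdeg[of m i] that by (simp add: monoms_upto_def)
  moreover have "Poly_Mapping.lookup m i = 0" if "m \<in> monoms_upto n d" "\<not> i < n" for m i
    using that by (auto simp: monoms_upto_def monoms_def in_keys_iff subset_iff)
  ultimately have "Poly_Mapping.lookup ` monoms_upto n d \<subseteq>
      {f. \<forall>i. (i \<in> {..<n} \<longrightarrow> f i \<in> {..d}) \<and> (i \<notin> {..<n} \<longrightarrow> f i = 0)}"
    by auto
  moreover have "finite {f. \<forall>i. (i \<in> {..<n} \<longrightarrow> f i \<in> {..d}) \<and> (i \<notin> {..<n} \<longrightarrow> f i = (0::nat))}"
    by (rule finite_set_of_finite_funs) auto
  ultimately show "finite (Poly_Mapping.lookup ` monoms_upto n d)"
    by (rule finite_subset)
qed

lemma finite_monoms_deg [simp]: "finite (monoms_deg n d)"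
  by (rule finite_subset[OF _ finite_monoms_upto[of n d]]) (auto simp: monoms_deg_def monoms_upto_def)

lemma lookup_hcomp [simp]:
  "Poly_Mapping.lookup (hcomp d f) m = (if tdeg m = d then Poly_Mapping.lookup f m else 0)"
proof -
  have "finite {m. (if tdeg m = d then Poly_Mapping.lookup f m else 0) \<noteq> 0}"
    by (rule finite_subset[OF _ finite_keys[of f]]) (auto simp: in_keys_iff split: if_splits)
  then show ?thesis
    by (simp add: hcomp_def)
qed

lemma keys_hcomp: "Poly_Mapping.keys (hcomp d f) = {m \<in> Poly_Mapping.keys f. tdeg m = d}"
  by (auto simp: in_keys_iff split: if_splits)

lemma hcomp_sum: "hcomp d (\<Sum>x\<in>A. F x) = (\<Sum>x\<in>A. hcomp d (F x))"
  by (rule poly_mapping_eqI) (simp add: lookup_sum)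

lemma hcomp_eq_0_iff: "hcomp d f = 0 \<longleftrightarrow> (\<forall>m\<in>Poly_Mapping.keys f. tdeg m \<noteq> d)"
  by (auto simp: poly_mapping_eq_iff fun_eq_iff in_keys_iff)

lemma hcomp_id: "(\<And>m. m \<in> Poly_Mapping.keys f \<Longrightarrow> tdeg m = d) \<Longrightarrow> hcomp d f = f"
  by (rule poly_mapping_eqI) (auto simp: in_keys_iff)

lemma sum_hcomp: "f = (\<Sum>d\<in>tdeg ` Poly_Mapping.keys f. hcomp d f)"
proof (rule poly_mapping_eqI)
  fix m
  show "Poly_Mapping.lookup f m = Poly_Mapping.lookup (\<Sum>d\<in>tdeg ` Poly_Mapping.keys f. hcomp d f) m"
    by (cases "m \<in> Poly_Mapping.keys f") (auto simp: lookup_sum in_keys_iff)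
qed

section \<open>Polynomials in \<open>n\<close> variables and operations inside an ideal\<close>

lemma polys_const [simp]: "const c \<in> polys n"
  by (auto simp: polys_def)

lemma polys_0 [simp]: "0 \<in> polys n"
  by (simp add: polys_def)

lemma polys_add: "f \<in> polys n \<Longrightarrow> h \<in> polys n \<Longrightarrow> f + h \<in> polys n"
  using Poly_Mapping.keys_add[of f h] by (auto simp: polys_def)

lemma polys_mult: "f \<in> polys n \<Longrightarrow> h \<in> polys n \<Longrightarrow> f * h \<in> polys n"
  using keys_mult[of f h] by (fastforce simp: polys_def intro: monoms_add)

lemma polys_sum: "(\<And>x. x \<in> A \<Longrightarrow> F x \<in> polys n) \<Longrightarrow> (\<Sum>x\<in>A. F x) \<in> polys n"
  by (induction A rule: infinite_finite_induct) (auto simp: polys_add)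

lemma polys_single: "m \<in> monoms n \<Longrightarrow> Poly_Mapping.single m c \<in> polys n"
  by (auto simp: polys_def)

lemma ideal_scale: "is_ideal n I \<Longrightarrow> f \<in> I \<Longrightarrow> const c * f \<in> I"
  by (auto simp: is_ideal_def)

lemma ideal_sum: "is_ideal n I \<Longrightarrow> (\<And>x. x \<in> A \<Longrightarrow> F x \<in> I) \<Longrightarrow> (\<Sum>x\<in>A. F x) \<in> I"
  by (induction A rule: infinite_finite_induct) (auto simp: is_ideal_def)

lemma ideal_diff: "is_ideal n I \<Longrightarrow> f \<in> I \<Longrightarrow> h \<in> I \<Longrightarrow> f - h \<in> I"
proof -
  assume *: "is_ideal n I" "f \<in> I" "h \<in> I"
  have "f + const (-1) * h \<in> I"
    using * ideal_scale[of n I h "-1"] by (auto simp: is_ideal_def)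
  moreover have "f + const (-1) * h = f - h"
    by (rule poly_mapping_eqI) (simp add: lookup_add lookup_minus)
  ultimately show ?thesis by simp
qed

section \<open>Linear coordinate changes\<close>

definition homog :: "nat \<Rightarrow> nat \<Rightarrow> 'a::comm_ring_1 mpoly set" where
  "homog n d = {f. Poly_Mapping.keys f \<subseteq> monoms_deg n d}"

lemma homog_polys: "homog n d \<subseteq> polys n"
  by (auto simp: homog_def polys_def monoms_deg_def)

lemma homog_0 [simp]: "0 \<in> homog n d"
  by (simp add: homog_def)

lemma homog_add: "f \<in> homog n d \<Longrightarrow> h \<in> homog n d \<Longrightarrow> f + h \<in> homog n d"
  using Poly_Mapping.keys_add[of f h] by (auto simp: homog_def)

lemma homog_sum: "(\<And>x. x \<in> A \<Longrightarrow> F x \<in> homog n d) \<Longrightarrow> (\<Sum>x\<in>A. F x) \<in> homog n d"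
  by (induction A rule: infinite_finite_induct) (auto simp: homog_add)

lemma homog_mult: "f \<in> homog n d \<Longrightarrow> h \<in> homog n e \<Longrightarrow> f * h \<in> homog n (d + e)"
  using keys_mult[of f h] by (fastforce simp: homog_def monoms_deg_def tdeg_add intro: monoms_add)

lemma homog_const [simp]: "const c \<in> homog n 0"
  by (auto simp: homog_def monoms_deg_def)

lemma homog_power: "f \<in> homog n d \<Longrightarrow> f ^ k \<in> homog n (k * d)"
proof (induction k)
  case 0
  show ?case using homog_const[of 1] by simp
next
  case (Suc k)
  then show ?case using homog_mult[of f n d "f ^ k" "k * d"] by simp
qed

lemma homog_prod:
  "(\<And>x. x \<in> A \<Longrightarrow> F x \<in> homog n (e x)) \<Longrightarrow> finite A \<Longrightarrow> (\<Prod>x\<in>A. F x) \<in> homog n (\<Sum>x\<in>A. e x)"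
proof (induction A rule: infinite_finite_induct)
  case empty
  show ?case using homog_const[of 1] by simp
qed (auto intro!: homog_mult)

lemma homog_hcomp: "f \<in> polys n \<Longrightarrow> hcomp d f \<in> homog n d"
  by (auto simp: homog_def polys_def monoms_deg_def keys_hcomp)

lemma hcomp_homog: "f \<in> homog n d \<Longrightarrow> hcomp e f = (if e = d then f else 0)"
  by (auto simp: hcomp_eq_0_iff homog_def monoms_deg_def intro!: hcomp_id)

abbreviation coord :: "nat \<Rightarrow> 'a::comm_ring_1 mat \<Rightarrow> 'a mpoly \<Rightarrow> 'a mpoly" where
  "coord n g \<equiv> subst (lin_form n g)"

lemma lin_form_homog: "lin_form n g i \<in> homog n 1"
  unfolding lin_form_def
  by (rule homog_sum) (auto simp: homog_def monoms_deg_def monoms_def)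

text \<open>A monomial of degree \<open>d\<close> turns into a product of \<open>d\<close> linear
  forms, counted with multiplicity.\<close>

lemma coord_homog:
  assumes "f \<in> homog n d"
  shows "coord n g f \<in> homog n d"
  unfolding subst_def
proof (rule homog_sum)
  fix m assume "m \<in> Poly_Mapping.keys f"
  then have d: "d = (\<Sum>i\<in>Poly_Mapping.keys m. Poly_Mapping.lookup m i)"
    using assms by (auto simp: homog_def monoms_deg_def tdeg_def)
  have "(\<Prod>i\<in>Poly_Mapping.keys m. lin_form n g i ^ Poly_Mapping.lookup m i) \<in> homog n d"
    unfolding d using homog_power[OF lin_form_homog] by (intro homog_prod) auto
  then show "const (Poly_Mapping.lookup f m) *
      (\<Prod>i\<in>Poly_Mapping.keys m. lin_form n g i ^ Poly_Mapping.lookup m i) \<in> homog n d"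
    using homog_mult[OF homog_const] by force
qed

text \<open>Split \<open>f\<close> into homogeneous components: each keeps its degree under
  \<open>coord\<close>, so extracting degree \<open>d\<close> afterwards picks the image of exactly
  one of them.\<close>

lemma hcomp_coord:
  assumes "f \<in> polys n"
  shows "hcomp d (coord n g f) = coord n g (hcomp d f)"
proof -
  have h: "coord n g (hcomp e f) \<in> homog n e" for e
    by (intro coord_homog homog_hcomp assms)
  have "hcomp d (coord n g f) = hcomp d (coord n g (\<Sum>e\<in>tdeg ` Poly_Mapping.keys f. hcomp e f))"
    using sum_hcomp[of f] by simp
  also have "\<dots> = (\<Sum>e\<in>tdeg ` Poly_Mapping.keys f. if d = e then coord n g (hcomp e f) else 0)"
    by (simp only: subst_sum hcomp_sum hcomp_homog[OF h])
  also have "\<dots> = coord n g (hcomp d f)"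
  proof (cases "d \<in> tdeg ` Poly_Mapping.keys f")
    case False
    then have "hcomp d f = 0" by (auto simp: hcomp_eq_0_iff)
    with False show ?thesis by (simp add: subst_zero)
  qed auto
  finally show ?thesis .
qed

lemma coord_polys:
  assumes "f \<in> polys n"
  shows "coord n g f \<in> polys n"
proof -
  have "coord n g (hcomp d f) \<in> polys n" for d
    using coord_homog[OF homog_hcomp[OF assms]] homog_polys by blast
  then have "(\<Sum>d\<in>tdeg ` Poly_Mapping.keys f. coord n g (hcomp d f)) \<in> polys n"
    by (intro polys_sum)
  then show ?thesis
    using sum_hcomp[of f] by (metis subst_sum)
qed

text \<open>Substituting the forms of \<open>g\<close> into those of \<open>h\<close> sends variable
  \<open>i\<close> to the linear form of row \<open>i\<close> of \<open>h * g\<close>; this dictates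
  the order of the factors.\<close>

lemma coord_inverse:
  fixes g h :: "'a::comm_ring_1 mat"
  assumes gh: "g \<in> carrier_mat n n" "h \<in> carrier_mat n n" "h * g = 1\<^sub>m n"
    and f: "f \<in> polys n"
  shows "coord n g (coord n h f) = f"
proof -
  have lin: "coord n g (lin_form n h i) = Poly_Mapping.single (Poly_Mapping.single i 1) 1" if i: "i < n" for i
  proof -
    have ent: "(\<Sum>j<n. h $$ (i, j) * g $$ (j, k)) = (if i = k then 1 else 0)" if k: "k < n" for k
    proof -
      have "(h * g) $$ (i, k) = (\<Sum>j<n. h $$ (i, j) * g $$ (j, k))"
        using gh(1,2) i k by (auto simp: scalar_prod_def atLeast0LessThan)
      moreover have "(h * g) $$ (i, k) = (if i = k then 1 else 0)"
        unfolding gh(3) using i k by simp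
      ultimately show ?thesis by simp
    qed
    have "coord n g (lin_form n h i) = (\<Sum>j<n. const (h $$ (i, j)) * lin_form n g j)"
      unfolding lin_form_def[of n h] by (simp add: subst_sum subst_single)
    also have "\<dots> = (\<Sum>k<n. Poly_Mapping.single (Poly_Mapping.single k 1) (\<Sum>j<n. h $$ (i, j) * g $$ (j, k)))"
    proof -
      have sgl: "Poly_Mapping.single m (\<Sum>x\<in>A. F x) = (\<Sum>x\<in>A. Poly_Mapping.single m (F x))"
        for m :: "nat \<Rightarrow>\<^sub>0 nat" and A :: "nat set" and F :: "nat \<Rightarrow> 'a"
        by (induction A rule: infinite_finite_induct) (auto simp: single_add)
      have "(\<Sum>j<n. const (h $$ (i, j)) * lin_form n g j) =
          (\<Sum>j<n. \<Sum>k<n. Poly_Mapping.single (Poly_Mapping.single k 1) (h $$ (i, j) * g $$ (j, k)))"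
        by (simp add: lin_form_def sum_distrib_left mult_single)
      also have "\<dots> = (\<Sum>k<n. \<Sum>j<n. Poly_Mapping.single (Poly_Mapping.single k 1) (h $$ (i, j) * g $$ (j, k)))"
        by (rule sum.swap)
      finally show ?thesis
        by (simp only: sgl)
    qed
    also have "\<dots> = (\<Sum>k<n. if i = k then Poly_Mapping.single (Poly_Mapping.single k 1) 1 else 0)"
      by (intro sum.cong) (auto simp: ent)
    also have "\<dots> = Poly_Mapping.single (Poly_Mapping.single i 1) 1"
      using i by simp
    finally show ?thesis .
  qed
  have "coord n g (coord n h f) = (\<Sum>m\<in>Poly_Mapping.keys f. const (Poly_Mapping.lookup f m) *
      (\<Prod>i\<in>Poly_Mapping.keys m. coord n g (lin_form n h i) ^ Poly_Mapping.lookup m i))"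
    unfolding subst_subst by (simp add: subst_def)
  also have "\<dots> = (\<Sum>m\<in>Poly_Mapping.keys f. Poly_Mapping.single m (Poly_Mapping.lookup f m))"
  proof (rule sum.cong)
    fix m assume "m \<in> Poly_Mapping.keys f"
    then have km: "Poly_Mapping.keys m \<subseteq> {..<n}"
      using f by (auto simp: polys_def monoms_def)
    have pw: "Poly_Mapping.single (Poly_Mapping.single i 1) (1::'a) ^ k =
        Poly_Mapping.single (Poly_Mapping.single i k) 1" for i k :: nat
      by (induction k) (auto simp: mult_single single_add[symmetric])
    have pr: "(\<Prod>i\<in>A. Poly_Mapping.single (F i) (1::'a)) = Poly_Mapping.single (\<Sum>i\<in>A. F i) 1"
      for A :: "nat set" and F :: "nat \<Rightarrow> nat \<Rightarrow>\<^sub>0 nat"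
      by (induction A rule: infinite_finite_induct) (auto simp: mult_single)
    have "(\<Prod>i\<in>Poly_Mapping.keys m. coord n g (lin_form n h i) ^ Poly_Mapping.lookup m i) =
        (\<Prod>i\<in>Poly_Mapping.keys m. Poly_Mapping.single (Poly_Mapping.single i (Poly_Mapping.lookup m i)) (1::'a))"
      using km by (intro prod.cong refl) (auto simp: lin pw[unfolded One_nat_def] subset_iff)
    also have "\<dots> = Poly_Mapping.single m 1"
      using sum_monomials[of "Poly_Mapping.keys m" m] by (simp add: pr)
    finally show "const (Poly_Mapping.lookup f m) *
        (\<Prod>i\<in>Poly_Mapping.keys m. coord n g (lin_form n h i) ^ Poly_Mapping.lookup m i) =
        Poly_Mapping.single m (Poly_Mapping.lookup f m)"
      by (simp add: mult_single)
  qed simp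
  also have "\<dots> = f"
    using sum_monomials[of "Poly_Mapping.keys f" f] by simp
  finally show ?thesis .
qed

section \<open>Invertible matrices and their action on graded ideals\<close>

lemma GL_inverse:
  assumes "g \<in> GL n"
  obtains h where "h \<in> carrier_mat n n" "g * h = 1\<^sub>m n" "h * g = 1\<^sub>m n"
proof -
  from assms have g: "g \<in> carrier_mat n n"
    by (simp add: GL_def)
  from assms obtain h where h: "inverts_mat g h" "inverts_mat h g"
    by (auto simp: GL_def invertible_mat_def)
  \<comment> \<open>\<open>inverts_mat\<close> does not record the shape of \<open>h\<close>;
    counting the columns of both products recovers it.\<close>
  have "dim_col (g * h) = dim_col (1\<^sub>m n :: 'a mat)" "dim_col (h * g) = dim_col (1\<^sub>m (dim_row h) :: 'a mat)"
    using h g unfolding inverts_mat_def by auto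
  then have "dim_col h = n" "dim_row h = n"
    using g by auto
  then show thesis
    using h g by (intro that[of h]) (auto simp: inverts_mat_def)
qed

text \<open>Turns invertibility into the nonvanishing of a polynomial in the entries, which can be
  multiplied with the other generic conditions.\<close>

lemma GL_iff_det:
  fixes g :: "'a::field mat"
  shows "g \<in> GL n \<longleftrightarrow> g \<in> carrier_mat n n \<and> det g \<noteq> 0"
proof
  assume g: "g \<in> GL n"
  then obtain h where "h \<in> carrier_mat n n" "g * h = 1\<^sub>m n" "h * g = 1\<^sub>m n"
    by (rule GL_inverse)
  with g show "g \<in> carrier_mat n n \<and> det g \<noteq> 0"
    using det_mult[of g n h] by (auto simp: GL_def)
next
  assume g: "g \<in> carrier_mat n n \<and> det g \<noteq> 0"
  then obtain h where "h \<in> carrier_mat n n" "h * g = 1\<^sub>m n"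
    using det_non_zero_imp_unit[of g n] by (auto simp: Units_def ring_mat_def)
  with g show "g \<in> GL n"
    using mat_mult_left_right_inverse[of h n g]
    by (auto simp: GL_def invertible_mat_def inverts_mat_def square_mat.simps)
qed

lemma coord_inj:
  assumes "g \<in> GL n"
  shows "inj_on (coord n g) (polys n)"
proof -
  obtain h where "h \<in> carrier_mat n n" "g * h = 1\<^sub>m n"
    using assms by (rule GL_inverse)
  then have "coord n h (coord n g f) = f" if "f \<in> polys n" for f
    using coord_inverse[of h n g f] assms that by (auto simp: GL_def)
  then show ?thesis
    by (rule inj_on_inverseI)
qed

lemma graded_act:
  assumes I: "graded_ideal n I" and g: "g \<in> GL n"
  shows "graded_ideal n (act n g I)"
proof -
  obtain h where h: "h \<in> carrier_mat n n" "h * g = 1\<^sub>m n"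
    using g by (rule GL_inverse)
  have Ip: "I \<subseteq> polys n" and I0: "0 \<in> I" and Ia: "\<And>f k. f \<in> I \<Longrightarrow> k \<in> I \<Longrightarrow> f + k \<in> I"
    and Im: "\<And>f q. f \<in> I \<Longrightarrow> q \<in> polys n \<Longrightarrow> q * f \<in> I"
    and Ih: "\<And>f d. f \<in> I \<Longrightarrow> hcomp d f \<in> I"
    using I by (auto simp: graded_ideal_def is_ideal_def)
  have "q * coord n g f \<in> act n g I" if "f \<in> I" "q \<in> polys n" for f q
  proof -
    \<comment> \<open>The multiplier \<open>q\<close> is itself the image of
      \<open>coord n h q\<close>, so the product is taken inside \<open>I\<close> before
      substituting.\<close>
    have "q * coord n g f = coord n g (coord n h q * f)"
      using coord_inverse[of g n h q] g h that by (simp add: subst_mult GL_def)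
    then show ?thesis
      using Im[OF that(1) coord_polys[OF that(2)]] by (auto simp: act_def)
  qed
  moreover have "hcomp d (coord n g f) \<in> act n g I" if "f \<in> I" for f d
    using hcomp_coord[of f n d g] Ip Ih that by (auto simp: act_def)
  moreover have "0 \<in> act n g I"
    using I0 subst_zero[of "lin_form n g"] unfolding act_def by (metis imageI)
  moreover have "act n g I \<subseteq> polys n"
    using Ip coord_polys by (auto simp: act_def)
  moreover have "coord n g f + coord n g k \<in> act n g I" if "f \<in> I" "k \<in> I" for f k
    using Ia[OF that] by (auto simp: act_def subst_add[symmetric])
  ultimately show ?thesis
    by (auto simp: graded_ideal_def is_ideal_def act_def)
qed

text \<open>A preimage of a form of degree \<open>d\<close> may be replaced by its own component of
  degree \<open>d\<close>, which stays in \<open>I\<close> because \<open>I\<close> is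
  graded.\<close>

lemma homog_act:
  assumes I: "graded_ideal n I" and g: "g \<in> GL n"
  shows "act n g I \<inter> homog n d = coord n g ` (I \<inter> homog n d)"
proof
  show "coord n g ` (I \<inter> homog n d) \<subseteq> act n g I \<inter> homog n d"
    using coord_homog by (auto simp: act_def)
  show "act n g I \<inter> homog n d \<subseteq> coord n g ` (I \<inter> homog n d)"
  proof
    fix x assume x: "x \<in> act n g I \<inter> homog n d"
    then obtain f where f: "f \<in> I" "x = coord n g f"
      by (auto simp: act_def)
    then have fp: "f \<in> polys n" and "hcomp d f \<in> I"
      using I by (auto simp: graded_ideal_def is_ideal_def)
    moreover have "x = coord n g (hcomp d f)"
      using hcomp_homog[of x n d d] hcomp_coord[OF fp] x f(2) by simp
    ultimately show "x \<in> coord n g ` (I \<inter> homog n d)"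
      using homog_hcomp[OF fp] by auto
  qed
qed

section \<open>Monomial ideals with a given Hilbert function\<close>

lemma nat_seq_mono_subseq:
  fixes f :: "nat \<Rightarrow> nat"
  obtains r :: "nat \<Rightarrow> nat" where "strict_mono r" "\<And>i j. i \<le> j \<Longrightarrow> f (r i) \<le> f (r j)"
proof -
  obtain s where s: "strict_mono s" "monoseq (\<lambda>n. f (s n))"
    using seq_monosub by blast
  show thesis
  proof (cases "\<forall>m n. m \<le> n \<longrightarrow> f (s m) \<le> f (s n)")
    case True
    with s show thesis by (intro that[of s]) auto
  next
    case False
    with s(2) have dec: "\<And>m n. m \<le> n \<Longrightarrow> f (s n) \<le> f (s m)"
      unfolding monoseq_def by blast
    \<comment> \<open>A nonincreasing sequence of naturals is constant from a position of its least
      value on.\<close>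
    obtain N where N: "\<And>n. f (s N) \<le> f (s n)"
      using exists_least_iff[of "\<lambda>v. \<exists>n. f (s n) = v"] by (metis not_le)
    have "strict_mono (\<lambda>n. s (N + n))"
      using s(1) by (auto simp: strict_mono_def)
    moreover have "f (s (N + i)) \<le> f (s (N + j))" for i j
      using dec[of N "N + i"] N[of "N + j"] by simp
    ultimately show thesis by (intro that) auto
  qed
qed

text \<open>Thin out the sequence once per variable, so that one exponent after another becomes
  nondecreasing. After \<open>n\<close> rounds the first remaining monomial divides the
  second.\<close>

lemma dickson_sequence:
  fixes a :: "nat \<Rightarrow> nat \<Rightarrow>\<^sub>0 nat"
  assumes "\<And>k. a k \<in> monoms n"
  obtains i j c where "i < j" "a j = a i + c"
proof -
  have "\<exists>r :: nat \<Rightarrow> nat. strict_mono r \<and>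
      (\<forall>i<k. \<forall>u v. u \<le> v \<longrightarrow> Poly_Mapping.lookup (a (r u)) i \<le> Poly_Mapping.lookup (a (r v)) i)" for k
  proof (induction k)
    case 0
    show ?case by (auto intro!: exI[of _ id] simp: strict_mono_def)
  next
    case (Suc k)
    then obtain r :: "nat \<Rightarrow> nat" where r: "strict_mono r"
      "\<And>i u v. i < k \<Longrightarrow> u \<le> v \<Longrightarrow> Poly_Mapping.lookup (a (r u)) i \<le> Poly_Mapping.lookup (a (r v)) i"
      by blast
    obtain s :: "nat \<Rightarrow> nat" where s: "strict_mono s"
      "\<And>u v. u \<le> v \<Longrightarrow> Poly_Mapping.lookup (a (r (s u))) k \<le> Poly_Mapping.lookup (a (r (s v))) k"
      by (rule nat_seq_mono_subseq[of "\<lambda>u. Poly_Mapping.lookup (a (r u)) k"]) (rule that)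
    have "strict_mono (r \<circ> s)"
      using r(1) s(1) by (rule strict_mono_o)
    moreover have "Poly_Mapping.lookup (a ((r \<circ> s) u)) i \<le> Poly_Mapping.lookup (a ((r \<circ> s) v)) i"
      if "i < Suc k" "u \<le> v" for i u v
      using r(2)[of i "s u" "s v"] s that
      by (cases "i = k") (auto simp: strict_mono_less_eq)
    ultimately show ?case by (intro exI[of _ "r \<circ> s"]) blast
  qed
  from this[of n] obtain r :: "nat \<Rightarrow> nat" where r: "strict_mono r"
    "\<And>i u v. i < n \<Longrightarrow> u \<le> v \<Longrightarrow> Poly_Mapping.lookup (a (r u)) i \<le> Poly_Mapping.lookup (a (r v)) i"
    by blast
  have "Poly_Mapping.lookup (a (r 0)) i \<le> Poly_Mapping.lookup (a (r 1)) i" for i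
  proof (cases "i < n")
    case False
    with assms[of "r 0"] have "i \<notin> Poly_Mapping.keys (a (r 0))"
      by (auto simp: monoms_def)
    then show ?thesis by (simp add: in_keys_iff)
  qed (use r(2)[of i 0 1] in simp)
  \<comment> \<open>Subtraction of exponents is truncated; it is exact here because every exponent
    of \<open>a (r 0)\<close> is dominated.\<close>
  then have "a (r 1) = a (r 0) + (a (r 1) - a (r 0))"
    by (intro poly_mapping_eqI) (simp add: lookup_add lookup_minus)
  moreover have "r 0 < r 1"
    using r(1) by (simp add: strict_mono_def)
  ultimately show thesis by (rule that[rotated])
qed

definition mono_ideal :: "nat \<Rightarrow> (nat \<Rightarrow>\<^sub>0 nat) set \<Rightarrow> bool" where
  "mono_ideal n M \<longleftrightarrow> M \<subseteq> monoms n \<and> (\<forall>m\<in>M. \<forall>c\<in>monoms n. m + c \<in> M)"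

text \<open>For the exponent set of a monomial ideal: all minimal generators have degree at most
  \<open>D\<close>.\<close>

definition generated_upto :: "nat \<Rightarrow> (nat \<Rightarrow>\<^sub>0 nat) set \<Rightarrow> bool" where
  "generated_upto D M \<longleftrightarrow> (\<forall>m\<in>M. \<exists>m'\<in>M. tdeg m' \<le> D \<and> (\<exists>c. m = m' + c))"

lemma generated_upto_mono: "generated_upto d M \<Longrightarrow> d \<le> e \<Longrightarrow> generated_upto e M"
  unfolding generated_upto_def by (meson order_trans)

lemma dickson:
  assumes "M \<subseteq> monoms n"
  obtains D where "generated_upto D M"
proof (rule ccontr)
  assume "\<not> thesis"
  with that have "\<forall>D. \<exists>m\<in>M. \<forall>m'\<in>M. tdeg m' \<le> D \<longrightarrow> (\<forall>c. m \<noteq> m' + c)"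
    unfolding generated_upto_def by blast
  then obtain b where b: "\<And>D. b D \<in> M" "\<And>D m' c. m' \<in> M \<Longrightarrow> tdeg m' \<le> D \<Longrightarrow> b D \<noteq> m' + c"
    by metis
  \<comment> \<open>The bound is raised past the degree of each chosen element, so no later choice
    is a multiple of an earlier one.\<close>
  define e where "e = rec_nat 0 (\<lambda>_ D. max D (tdeg (b D)))"
  have e_Suc: "e (Suc k) = max (e k) (tdeg (b (e k)))" for k
    by (simp add: e_def)
  have "mono e"
    by (simp add: mono_iff_le_Suc e_Suc)
  obtain i j c where ij: "i < j" "b (e j) = b (e i) + c"
    using dickson_sequence[of "\<lambda>k. b (e k)" n] b(1) assms by blast
  have "tdeg (b (e i)) \<le> e (Suc i)"
    by (simp add: e_Suc)
  also have "\<dots> \<le> e j"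
    using \<open>mono e\<close> ij(1) by (simp add: monoD)
  finally show False
    using b ij(2) by blast
qed

text \<open>Compactness: infinitely many ideals violating every bound would have a limit ideal with the
  same Hilbert function, and by Dickson's lemma the limit is determined by finitely many degrees.\<close>

lemma hilbert_function_bound:
  fixes H :: "nat \<Rightarrow> nat"
  obtains D where "\<And>M. mono_ideal n M \<Longrightarrow> (\<And>d. card (M \<inter> monoms_deg n d) = H d) \<Longrightarrow> generated_upto D M"
proof (rule ccontr)
  assume "\<not> thesis"
  with that have "\<forall>D. \<exists>M. mono_ideal n M \<and> (\<forall>d. card (M \<inter> monoms_deg n d) = H d) \<and> \<not> generated_upto D M"
    by blast
  then obtain M where M: "\<And>D. mono_ideal n (M D)" "\<And>D d. card (M D \<inter> monoms_deg n d) = H d"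
    "\<And>D. \<not> generated_upto D (M D)"
    by metis
  \<comment> \<open>Koenig's lemma: \<open>P d T\<close> marks a truncation shared by infinitely
    many counterexamples, and by the pigeonhole principle each such truncation extends to the next
    degree.\<close>
  define P where "P d T \<longleftrightarrow> infinite {D. M D \<inter> monoms_upto n d = T}" for d T
  have pigeon: "\<exists>T'. P e T' \<and> T' \<inter> monoms_upto n d = T"
    if inf: "infinite A" and A: "\<And>D. D \<in> A \<Longrightarrow> M D \<inter> monoms_upto n d = T" and de: "d \<le> e" for A d e T
  proof -
    have "finite ((\<lambda>D. M D \<inter> monoms_upto n e) ` A)"
      by (rule finite_subset[of _ "Pow (monoms_upto n e)"]) auto
    then obtain D0 where D0: "D0 \<in> A" "infinite {D \<in> A. M D \<inter> monoms_upto n e = M D0 \<inter> monoms_upto n e}"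
      using pigeonhole_infinite[OF inf] by blast
    then have "P e (M D0 \<inter> monoms_upto n e)"
      unfolding P_def by (elim infinite_super[rotated]) auto
    moreover have "M D0 \<inter> monoms_upto n e \<inter> monoms_upto n d = T"
      using A[OF D0(1)] de by (auto simp: monoms_upto_def)
    ultimately show ?thesis by blast
  qed
  have "\<exists>T. \<forall>d. P d (T d) \<and> T (Suc d) \<inter> monoms_upto n d = T d"
  proof (rule dependent_nat_choice)
    show "\<exists>T. P 0 T"
    proof -
      have "finite (range (\<lambda>D. M D \<inter> monoms_upto n 0))"
        by (rule finite_subset[of _ "Pow (monoms_upto n 0)"]) auto
      then obtain D0 where "infinite {D \<in> UNIV. M D \<inter> monoms_upto n 0 = M D0 \<inter> monoms_upto n 0}"
        using pigeonhole_infinite[of UNIV "\<lambda>D. M D \<inter> monoms_upto n 0"] by auto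
      then show ?thesis
        unfolding P_def by (intro exI[of _ "M D0 \<inter> monoms_upto n 0"]) simp
    qed
    show "\<exists>T'. P (Suc d) T' \<and> T' \<inter> monoms_upto n d = T" if "P d T" for T d
      by (rule pigeon[of "{D. M D \<inter> monoms_upto n d = T}"]) (use that in \<open>simp_all add: P_def\<close>)
  qed
  then obtain T where T: "\<And>d. P d (T d)" "\<And>d. T (Suc d) \<inter> monoms_upto n d = T d"
    by blast
  have T_sub: "T d \<subseteq> monoms_upto n d" for d
    using T(2)[of d] by blast
  have T_restrict: "T (d + k) \<inter> monoms_upto n d = T d" for d k
  proof (induction k)
    case 0
    show ?case using T_sub[of d] by auto
  next
    case (Suc k)
    have "monoms_upto n d \<subseteq> monoms_upto n (d + k)"
      by (auto simp: monoms_upto_def)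
    with Suc T(2)[of "d + k"] show ?case by auto
  qed
  define L where "L = (\<Union>d. T d)"
  have L_trunc: "L \<inter> monoms_upto n d = T d" for d
  proof
    show "T d \<subseteq> L \<inter> monoms_upto n d"
      using T_sub[of d] by (auto simp: L_def)
    show "L \<inter> monoms_upto n d \<subseteq> T d"
    proof
      fix m assume m: "m \<in> L \<inter> monoms_upto n d"
      then obtain e where e: "m \<in> T e" by (auto simp: L_def)
      have "T (d + e) \<inter> monoms_upto n e = T e"
        using T_restrict[of e d] by (simp add: add.commute)
      with e m T_restrict[of d e] show "m \<in> T d" by auto
    qed
  qed
  have approx: "\<exists>D\<ge>k. M D \<inter> monoms_upto n d = L \<inter> monoms_upto n d" for d k
    using T(1)[of d] unfolding P_def L_trunc infinite_nat_iff_unbounded_le by blast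
  have L_sub: "L \<subseteq> monoms n"
    using T_sub by (auto simp: L_def monoms_upto_def)
  obtain D0 where D0: "generated_upto D0 L"
    using dickson[OF L_sub] .
  \<comment> \<open>This counterexample will turn out to be \<open>L\<close>: it contains generators
    of \<open>L\<close>, hence \<open>L\<close>, and equal Hilbert functions leave room for nothing
    more. But then it is generated up to \<open>D0\<close>, which is at most \<open>D\<close>,
    against its choice.\<close>
  obtain D where D: "D \<ge> D0" "M D \<inter> monoms_upto n D0 = L \<inter> monoms_upto n D0"
    using approx by blast
  have "L \<subseteq> M D"
  proof
    fix m assume m: "m \<in> L"
    then obtain m' c where m': "m' \<in> L" "tdeg m' \<le> D0" "m = m' + c"
      using D0 by (auto simp: generated_upto_def)
    have "m' \<in> M D" "c \<in> monoms n"
      using m m' D(2) L_sub by (auto simp: monoms_upto_def monoms_add_iff)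
    with m'(3) M(1)[of D] show "m \<in> M D"
      by (auto simp: mono_ideal_def)
  qed
  have card_L: "card (L \<inter> monoms_deg n d) = H d" for d
  proof -
    obtain D' where "M D' \<inter> monoms_upto n d = L \<inter> monoms_upto n d"
      using approx by blast
    moreover have "monoms_deg n d \<subseteq> monoms_upto n d"
      by (auto simp: monoms_deg_def monoms_upto_def)
    ultimately have "M D' \<inter> monoms_deg n d = L \<inter> monoms_deg n d"
      by blast
    with M(2)[of D' d] show ?thesis by simp
  qed
  have "M D \<subseteq> L"
  proof
    fix m assume m: "m \<in> M D"
    have "L \<inter> monoms_deg n (tdeg m) = M D \<inter> monoms_deg n (tdeg m)"
      using \<open>L \<subseteq> M D\<close> card_L M(2) by (intro card_subset_eq) auto
    with m M(1)[of D] show "m \<in> L"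
      by (auto simp: mono_ideal_def monoms_deg_def)
  qed
  with \<open>L \<subseteq> M D\<close> have "M D = L" by simp
  with D0 D(1) M(3)[of D] generated_upto_mono show False by metis
qed

section \<open>Leading monomials\<close>

text \<open>Graded pieces of ideals are compared by dimension; scalars act as multiplication by
  constants.\<close>

interpretation mp: vector_space "\<lambda>c f. const c * f :: 'a::field mpoly"
  by unfold_locales (auto simp: algebra_simps single_add mult_single mult.assoc[symmetric])

interpretation mp_pair: vector_space_pair
  "\<lambda>c f. const c * f :: 'a::field mpoly" "\<lambda>c f. const c * f :: 'a::field mpoly"
  by unfold_locales

lemma subspace_ideal: "is_ideal n I \<Longrightarrow> mp.subspace I"
  by (auto simp: mp.subspace_def is_ideal_def)

lemma subspace_keys: "mp.subspace {f :: 'a::field mpoly. Poly_Mapping.keys f \<subseteq> A}"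
proof -
  have "{f. Poly_Mapping.keys f \<subseteq> A} = {f :: 'a mpoly. \<forall>m. m \<notin> A \<longrightarrow> Poly_Mapping.lookup f m = 0}"
    by (auto simp: in_keys_iff subset_iff)
  then show ?thesis
    by (simp add: mp.subspace_def lookup_add)
qed

lemma subspace_homog: "mp.subspace (homog n d)"
  unfolding homog_def by (rule subspace_keys)

lemma subspace_Int: "mp.subspace V \<Longrightarrow> mp.subspace W \<Longrightarrow> mp.subspace (V \<inter> W)"
  by (simp add: mp.subspace_def)

lemma subspace_ideal_homog: "graded_ideal n I \<Longrightarrow> mp.subspace (I \<inter> homog n d)"
  by (auto simp: graded_ideal_def intro: subspace_Int subspace_ideal subspace_homog)

lemma ex_greatest_monom:
  assumes "term_order n lt" "finite A" "A \<noteq> {}" "A \<subseteq> monoms n"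
  shows "\<exists>m\<in>A. \<forall>m'\<in>A. m' \<noteq> m \<longrightarrow> lt m' m"
  using assms(2-4)
proof (induction rule: finite_ne_induct)
  case (insert x A)
  then obtain m where m: "m \<in> A" "\<And>m'. m' \<in> A \<Longrightarrow> m' \<noteq> m \<Longrightarrow> lt m' m" by auto
  have mon: "x \<in> monoms n" "m \<in> monoms n" "x \<noteq> m" "A \<subseteq> monoms n"
    using insert m(1) by auto
  then consider "lt x m" | "lt m x"
    using assms(1) unfolding term_order_def by blast
  then show ?case
  proof cases
    case 1
    with m show ?thesis by (intro bexI[of _ m]) auto
  next
    case 2
    have "lt m' x" if "m' \<in> A" for m'
    proof (cases "m' = m")
      case False
      with m(2) that have "lt m' m" by blast
      with 2 mon that show ?thesis
        using assms(1) unfolding term_order_def by blast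
    qed (use 2 in simp)
    then show ?thesis by (intro bexI[of _ x]) auto
  qed
qed simp

context
  fixes n :: nat and lt :: "(nat \<Rightarrow>\<^sub>0 nat) \<Rightarrow> (nat \<Rightarrow>\<^sub>0 nat) \<Rightarrow> bool"
  assumes lt: "term_order n lt"
begin

lemma lt_irrefl: "a \<in> monoms n \<Longrightarrow> \<not> lt a a"
  using lt by (auto simp: term_order_def)

lemma lt_trans: "lt a b \<Longrightarrow> lt b c \<Longrightarrow> a \<in> monoms n \<Longrightarrow> b \<in> monoms n \<Longrightarrow> c \<in> monoms n \<Longrightarrow> lt a c"
  using lt unfolding term_order_def by blast

lemma lt_add: "lt a b \<Longrightarrow> a \<in> monoms n \<Longrightarrow> b \<in> monoms n \<Longrightarrow> c \<in> monoms n \<Longrightarrow> lt (a + c) (b + c)"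
  using lt unfolding term_order_def by blast

lemma lead_monom_eqI:
  assumes "f \<in> polys n" "m \<in> Poly_Mapping.keys f"
    "\<And>m'. m' \<in> Poly_Mapping.keys f \<Longrightarrow> m' \<noteq> m \<Longrightarrow> lt m' m"
  shows "lead_monom lt f = m"
  unfolding lead_monom_def
proof (rule the_equality)
  fix k assume k: "k \<in> Poly_Mapping.keys f \<and> (\<forall>m'\<in>Poly_Mapping.keys f. m' \<noteq> k \<longrightarrow> lt m' k)"
  have "k \<in> monoms n" "m \<in> monoms n"
    using assms(1,2) k by (auto simp: polys_def)
  show "k = m"
  proof (rule ccontr)
    assume "k \<noteq> m"
    then have "lt k m" "lt m k"
      using assms k by auto
    then show False
      using lt_trans[of k m k] lt_irrefl[of k] \<open>k \<in> monoms n\<close> \<open>m \<in> monoms n\<close> by blast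
  qed
qed (use assms in auto)

lemma lead_monom:
  assumes "f \<in> polys n" "f \<noteq> 0"
  shows lead_monom_in_keys: "lead_monom lt f \<in> Poly_Mapping.keys f"
    and lead_monom_greatest: "m \<in> Poly_Mapping.keys f \<Longrightarrow> m \<noteq> lead_monom lt f \<Longrightarrow> lt m (lead_monom lt f)"
proof -
  have "Poly_Mapping.keys f \<noteq> {}" "Poly_Mapping.keys f \<subseteq> monoms n"
    using assms by (auto simp: polys_def)
  then obtain k where k: "k \<in> Poly_Mapping.keys f"
    "\<And>m'. m' \<in> Poly_Mapping.keys f \<Longrightarrow> m' \<noteq> k \<Longrightarrow> lt m' k"
    using ex_greatest_monom[OF lt finite_keys] by blast
  then have "lead_monom lt f = k"
    using lead_monom_eqI assms(1) by blast
  with k show "lead_monom lt f \<in> Poly_Mapping.keys f"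
    "m \<in> Poly_Mapping.keys f \<Longrightarrow> m \<noteq> lead_monom lt f \<Longrightarrow> lt m (lead_monom lt f)"
    by auto
qed

lemma lead_monom_monoms: "f \<in> polys n \<Longrightarrow> f \<noteq> 0 \<Longrightarrow> lead_monom lt f \<in> monoms n"
  using lead_monom_in_keys by (auto simp: polys_def)

text \<open>Allows replacing a polynomial by a homogeneous component, or by an element whose support
  is a circuit, without losing the leading monomial.\<close>

lemma lead_monom_subset:
  fixes f h :: "'a::comm_ring_1 mpoly"
  assumes "f \<in> polys n" "Poly_Mapping.keys h \<subseteq> Poly_Mapping.keys f" "lead_monom lt f \<in> Poly_Mapping.keys h"
  shows "lead_monom lt h = lead_monom lt f"
proof (rule lead_monom_eqI)
  show "h \<in> polys n"
    using assms by (auto simp: polys_def)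
  show "lt m (lead_monom lt f)" if "m \<in> Poly_Mapping.keys h" "m \<noteq> lead_monom lt f" for m
    using that assms lead_monom_greatest[of f m] by (cases "f = 0") auto
qed (use assms in auto)

lemma lead_monom_single_mult:
  fixes f :: "'a::idom mpoly"
  assumes "f \<in> polys n" "f \<noteq> 0" "c \<in> monoms n"
  shows "lead_monom lt (Poly_Mapping.single c 1 * f) = lead_monom lt f + c"
proof (rule lead_monom_eqI)
  have keys: "Poly_Mapping.keys (Poly_Mapping.single c 1 * f) = (+) c ` Poly_Mapping.keys f"
    by (rule keys_single_mult) simp
  show "Poly_Mapping.single c 1 * f \<in> polys n"
    using assms by (intro polys_mult polys_single)
  show "lead_monom lt f + c \<in> Poly_Mapping.keys (Poly_Mapping.single c 1 * f)"
    unfolding keys using lead_monom_in_keys[OF assms(1,2)] by (simp add: add.commute)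
  show "lt m' (lead_monom lt f + c)"
    if m': "m' \<in> Poly_Mapping.keys (Poly_Mapping.single c 1 * f)" "m' \<noteq> lead_monom lt f + c" for m'
  proof -
    obtain k where k: "k \<in> Poly_Mapping.keys f" "m' = k + c"
      using m'(1) unfolding keys by (auto simp: add.commute)
    with m'(2) have "lt k (lead_monom lt f)"
      using lead_monom_greatest[OF assms(1,2) k(1)] by auto
    moreover have "k \<in> monoms n"
      using k(1) assms(1) by (auto simp: polys_def)
    ultimately show ?thesis
      using k(2) assms lead_monom_monoms lt_add by blast
  qed
qed

text \<open>Gaussian elimination: subtracting a multiple of an element of \<open>W\<close> with the
  same leading monomial leaves zero or a smaller leading monomial. Only finitely many monomials are
  available, so the number of those below the leading one serves as induction measure.\<close>

lemma subspace_eq_if_lead_monoms: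
  fixes V W :: "'a::field mpoly set"
  assumes A: "finite A" "A \<subseteq> monoms n" and V: "mp.subspace V" "\<And>f. f \<in> V \<Longrightarrow> Poly_Mapping.keys f \<subseteq> A"
    and W: "mp.subspace W" "W \<subseteq> V"
    and lead: "\<And>f. f \<in> V \<Longrightarrow> f \<noteq> 0 \<Longrightarrow> \<exists>h\<in>W. h \<noteq> 0 \<and> lead_monom lt h = lead_monom lt f"
  shows "V = W"
proof
  have "f \<in> W" if "f \<in> V" for f
    using that
  proof (induction "card {a \<in> A. lt a (lead_monom lt f)}" arbitrary: f rule: less_induct)
    case less
    show ?case
    proof (cases "f = 0")
      case True
      then show ?thesis using W(1) by (simp add: mp.subspace_0)
    next
      case False
      have pol: "k \<in> polys n" if "k \<in> V" for k
        using V(2) A(2) that by (auto simp: polys_def)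
      obtain h where h: "h \<in> W" "h \<noteq> 0" "lead_monom lt h = lead_monom lt f"
        using lead[OF less.prems False] by blast
      define m where "m = lead_monom lt f"
      have hV: "h \<in> V" using h(1) W(2) by blast
      have m_h: "Poly_Mapping.lookup h m \<noteq> 0"
        using lead_monom_in_keys[OF pol[OF hV] h(2)] h(3) by (simp add: m_def in_keys_iff)
      have mA: "m \<in> A"
        using lead_monom_in_keys[OF pol[OF less.prems] False] V(2)[OF less.prems] by (auto simp: m_def)
      \<comment> \<open>This cancels the coefficient of \<open>m\<close>; every surviving monomial
        occurs in \<open>f\<close> or \<open>h\<close> and therefore lies below
        \<open>m\<close>.\<close>
      define f' where "f' = f - const (Poly_Mapping.lookup f m / Poly_Mapping.lookup h m) * h"
      have f'V: "f' \<in> V"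
        unfolding f'_def using less.prems hV V(1) by (intro mp.subspace_diff mp.subspace_scale)
      have "f' \<in> W"
      proof (cases "f' = 0")
        case True
        then show ?thesis using W(1) by (simp add: mp.subspace_0)
      next
        case f'0: False
        define k where "k = lead_monom lt f'"
        have k: "k \<in> Poly_Mapping.keys f'"
          unfolding k_def by (rule lead_monom_in_keys[OF pol[OF f'V] f'0])
        then have "Poly_Mapping.lookup f' k \<noteq> 0"
          by (simp add: in_keys_iff)
        then have "k \<noteq> m" "k \<in> Poly_Mapping.keys f \<or> k \<in> Poly_Mapping.keys h"
          using m_h by (auto simp: f'_def lookup_minus in_keys_iff)
        then have km: "lt k m"
          using lead_monom_greatest[OF pol[OF less.prems] False, of k]
            lead_monom_greatest[OF pol[OF hV] h(2), of k] h(3) by (auto simp: m_def)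
        have kA: "k \<in> A"
          using k V(2)[OF f'V] by auto
        have "lt a m" if "a \<in> A" "lt a k" for a
          using lt_trans[OF that(2) km] that(1) kA mA A(2) by auto
        moreover have "\<not> lt k k"
          using kA A(2) lt_irrefl by auto
        ultimately have "{a \<in> A. lt a k} \<subset> {a \<in> A. lt a m}"
          using km kA by auto
        then have "card {a \<in> A. lt a k} < card {a \<in> A. lt a m}"
          using A(1) by (intro psubset_card_mono) auto
        then show ?thesis
          using less.hyps[of f'] f'V by (simp add: k_def m_def)
      qed
      then have "f' + const (Poly_Mapping.lookup f m / Poly_Mapping.lookup h m) * h \<in> W"
        using h(1) W(1) by (intro mp.subspace_add mp.subspace_scale)
      then show ?thesis by (simp add: f'_def)
    qed
  qed
  then show "V \<subseteq> W" by blast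
qed (fact W(2))

text \<open>For an ideal, the exponents of its initial ideal. It is also applied to graded pieces,
  which are merely subspaces.\<close>

definition leads :: "'a::zero mpoly set \<Rightarrow> (nat \<Rightarrow>\<^sub>0 nat) set" where
  "leads V = lead_monom lt ` (V - {0})"

text \<open>Choosing one element of \<open>V\<close> per leading monomial gives a basis: distinct
  leading monomials force independence, and elimination shows that the choices span.\<close>

lemma card_leads:
  fixes V :: "'a::field mpoly set"
  assumes A: "finite A" "A \<subseteq> monoms n" and V: "mp.subspace V" "\<And>f. f \<in> V \<Longrightarrow> Poly_Mapping.keys f \<subseteq> A"
  shows "card (leads V) = mp.dim V"
proof -
  have pol: "k \<in> polys n" if "k \<in> V" for k
    using V(2) A(2) that by (auto simp: polys_def)
  have "\<forall>m\<in>leads V. \<exists>f. f \<in> V \<and> f \<noteq> 0 \<and> lead_monom lt f = m"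
    by (auto simp: leads_def)
  then obtain b where b: "\<And>m. m \<in> leads V \<Longrightarrow> b m \<in> V \<and> b m \<noteq> 0 \<and> lead_monom lt (b m) = m"
    by metis
  have leads_A: "leads V \<subseteq> A"
    using lead_monom_in_keys pol V(2) by (fastforce simp: leads_def)
  then have fin: "finite (leads V)"
    using A(1) by (rule finite_subset)
  have inj: "inj_on b (leads V)"
    by (rule inj_onI) (metis b)
  have indep: "mp.independent (b ` leads V)"
  proof (rule mp.independent_if_scalars_zero)
    show "finite (b ` leads V)" using fin by simp
    fix u x
    assume sum0: "(\<Sum>x\<in>b ` leads V. const (u x) * x) = 0" and x: "x \<in> b ` leads V"
    show "u x = 0"
    proof (rule ccontr)
      assume "u x \<noteq> 0"
      with x have "{m \<in> leads V. u (b m) \<noteq> 0} \<noteq> {}" by auto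
      moreover have "{m \<in> leads V. u (b m) \<noteq> 0} \<subseteq> monoms n"
        using leads_A A(2) by auto
      \<comment> \<open>In a vanishing combination, look at the greatest leading monomial that
        carries a nonzero scalar: all other contributing elements lie strictly below it and cannot
        cancel it.\<close>
      ultimately obtain m where m: "m \<in> leads V" "u (b m) \<noteq> 0"
        "\<And>m'. m' \<in> leads V \<Longrightarrow> u (b m') \<noteq> 0 \<Longrightarrow> m' \<noteq> m \<Longrightarrow> lt m' m"
        using ex_greatest_monom[OF lt, of "{m \<in> leads V. u (b m) \<noteq> 0}"] fin by auto
      have zero: "u (b m') * Poly_Mapping.lookup (b m') m = 0" if m': "m' \<in> leads V" "m' \<noteq> m" for m'
      proof (cases "u (b m') = 0")
        case False
        then have "lt m' m" using m' m(3) by blast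
        have mon: "m \<in> monoms n" "m' \<in> monoms n"
          using m(1) m'(1) leads_A A(2) by auto
        have "m \<notin> Poly_Mapping.keys (b m')"
        proof
          assume "m \<in> Poly_Mapping.keys (b m')"
          then have "lt m m'"
            using lead_monom_greatest[of "b m'" m] b[OF m'(1)] pol m'(2) by auto
          with \<open>lt m' m\<close> mon show False
            using lt_trans[of m m' m] lt_irrefl[of m] by blast
        qed
        then show ?thesis by (simp add: in_keys_iff)
      qed simp
      have "0 = Poly_Mapping.lookup (\<Sum>x\<in>b ` leads V. const (u x) * x) m"
        by (simp add: sum0)
      also have "\<dots> = (\<Sum>m'\<in>leads V. u (b m') * Poly_Mapping.lookup (b m') m)"
        by (simp add: sum.reindex[OF inj] lookup_sum)
      also have "\<dots> = u (b m) * Poly_Mapping.lookup (b m) m"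
        using zero m(1) fin by (subst sum.remove[of _ m]) (auto intro!: sum.neutral dest: zero)
      finally have "Poly_Mapping.lookup (b m) m = 0"
        using m(2) by simp
      moreover have "m \<in> Poly_Mapping.keys (b m)"
        using lead_monom_in_keys[of "b m"] b[OF m(1)] pol by auto
      ultimately show False by (simp add: in_keys_iff)
    qed
  qed
  have "V = mp.span (b ` leads V)"
  proof (rule subspace_eq_if_lead_monoms[OF A V])
    show "mp.span (b ` leads V) \<subseteq> V"
      using b V(1) by (intro mp.span_minimal) auto
    show "\<exists>h\<in>mp.span (b ` leads V). h \<noteq> 0 \<and> lead_monom lt h = lead_monom lt f"
      if "f \<in> V" "f \<noteq> 0" for f
    proof -
      have m: "lead_monom lt f \<in> leads V" using that by (auto simp: leads_def)
      with b[OF m] show ?thesis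
        by (intro bexI[of _ "b (lead_monom lt f)"]) (auto intro: mp.span_base)
    qed
  qed (auto simp: mp.subspace_span)
  then have "mp.dim V = card (b ` leads V)"
    using mp.dim_span_eq_card_independent[OF indep] by simp
  then show ?thesis by (simp add: card_image[OF inj])
qed

text \<open>The homogeneous component of \<open>f\<close> through its leading monomial is again in
  \<open>J\<close> and has the same leading monomial. Initial ideals can thus be studied in
  finite-dimensional pieces.\<close>

lemma leads_deg:
  assumes J: "graded_ideal n J"
  shows "leads J \<inter> monoms_deg n d = leads (J \<inter> homog n d)"
proof (intro equalityI subsetI)
  fix m assume m: "m \<in> leads J \<inter> monoms_deg n d"
  then obtain f where f: "f \<in> J" "f \<noteq> 0" "m = lead_monom lt f"
    by (auto simp: leads_def)
  have fp: "f \<in> polys n" and hJ: "hcomp d f \<in> J"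
    using f(1) J by (auto simp: graded_ideal_def is_ideal_def)
  have mk: "m \<in> Poly_Mapping.keys (hcomp d f)"
    using m lead_monom_in_keys[OF fp f(2)] by (auto simp: keys_hcomp f(3) monoms_deg_def)
  have "lead_monom lt (hcomp d f) = m"
    using lead_monom_subset[OF fp, of "hcomp d f"] mk f(3) by (auto simp: keys_hcomp)
  moreover have "hcomp d f \<noteq> 0"
    using mk by auto
  ultimately show "m \<in> leads (J \<inter> homog n d)"
    using hJ homog_hcomp[OF fp] by (force simp: leads_def)
next
  fix m assume "m \<in> leads (J \<inter> homog n d)"
  then obtain f where f: "f \<in> J" "f \<in> homog n d" "f \<noteq> 0" "m = lead_monom lt f"
    by (auto simp: leads_def)
  then show "m \<in> leads J \<inter> monoms_deg n d"
    using lead_monom_in_keys[of f] homog_polys[of n d] by (auto simp: leads_def homog_def)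
qed

lemma mono_ideal_leads:
  fixes J :: "'a::field mpoly set"
  assumes J: "is_ideal n J"
  shows "mono_ideal n (leads J)"
  unfolding mono_ideal_def
proof (intro conjI ballI subsetI)
  fix m assume "m \<in> leads J"
  then obtain f where f: "f \<in> J" "f \<noteq> 0" "m = lead_monom lt f"
    by (auto simp: leads_def)
  have fp: "f \<in> polys n"
    using f(1) J by (auto simp: is_ideal_def)
  show "m \<in> monoms n"
    using lead_monom_monoms[OF fp f(2)] f(3) by simp
  fix c assume c: "c \<in> monoms n"
  have "Poly_Mapping.single c 1 * f \<in> J"
    using J f(1) polys_single[OF c, of 1] by (auto simp: is_ideal_def)
  moreover have "Poly_Mapping.single c 1 * f \<noteq> 0"
    using keys_single_mult[of 1 c f] f(2) by auto
  ultimately show "m + c \<in> leads J"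
    using lead_monom_single_mult[OF fp f(2) c] f(3) by (force simp: leads_def)
qed

text \<open>The right-hand side does not mention \<open>lt\<close>: all initial ideals of
  \<open>J\<close> share the Hilbert function of \<open>J\<close>.\<close>

lemma card_leads_deg:
  fixes J :: "'a::field mpoly set"
  assumes J: "graded_ideal n J"
  shows "card (leads J \<inter> monoms_deg n d) = mp.dim (J \<inter> homog n d)"
  unfolding leads_deg[OF J]
proof (rule card_leads[of "monoms_deg n d"])
  show "mp.subspace (J \<inter> homog n d)"
    using J by (rule subspace_ideal_homog)
  show "monoms_deg n d \<subseteq> monoms n"
    by (auto simp: monoms_deg_def)
qed (auto simp: homog_def)

end

section \<open>Invariance of the Hilbert function under coordinate changes\<close>

lemma linear_coord:
  "Vector_Spaces.linear (\<lambda>c f. const c * f) (\<lambda>c f. const c * f) (coord n g :: 'a::field mpoly \<Rightarrow> _)"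
  unfolding Vector_Spaces.linear_iff
  by (auto simp: subst_add subst_mult subst_const mp.vector_space_axioms)

text \<open>The substitution is linear and injective, so it carries a basis of the degree
  \<open>d\<close> piece of \<open>I\<close> to a basis of that of \<open>g(I)\<close>.\<close>

lemma dim_act_homog:
  fixes I :: "'a::field mpoly set"
  assumes I: "graded_ideal n I" and g: "g \<in> GL n"
  shows "mp.dim (act n g I \<inter> homog n d) = mp.dim (I \<inter> homog n d)"
proof -
  let ?V = "I \<inter> homog n d"
  obtain B where B: "B \<subseteq> ?V" "mp.independent B" "?V \<subseteq> mp.span B" "card B = mp.dim ?V"
    by (rule mp.basis_exists)
  have "mp.subspace ?V"
    using I by (rule subspace_ideal_homog)
  then have sp: "mp.span B = ?V"
    using B mp.span_minimal by blast
  have inj: "inj_on (coord n g) ?V"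
    using homog_polys[of n d] by (intro inj_on_subset[OF coord_inj[OF g]]) auto
  have "mp.independent (coord n g ` B)"
    using mp_pair.linear_independent_injective_image[OF linear_coord B(2)] inj sp by simp
  moreover have "mp.span (coord n g ` B) = coord n g ` ?V"
    using mp_pair.linear_span_image[OF linear_coord, of n g B] sp by simp
  ultimately have "mp.dim (coord n g ` ?V) = card (coord n g ` B)"
    using mp.dim_span_eq_card_independent by metis
  also have "\<dots> = card B"
    using inj B(1) by (intro card_image) (auto intro: inj_on_subset)
  finally show ?thesis
    using B(4) homog_act[OF I g] by simp
qed

section \<open>Polynomial functions of a matrix\<close>

text \<open>The introduction rules give closure under the operations in a determinant, and rule
  induction yields both an explicit polynomial and the restriction to a line.\<close>

inductive polyfun :: "nat \<Rightarrow> ('a::comm_ring_1 mat \<Rightarrow> 'a) \<Rightarrow> bool" for n where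
  polyfun_const: "polyfun n (\<lambda>g. c)"
| polyfun_entry: "i < n \<Longrightarrow> j < n \<Longrightarrow> polyfun n (\<lambda>g. g $$ (i, j))"
| polyfun_add: "polyfun n F \<Longrightarrow> polyfun n G \<Longrightarrow> polyfun n (\<lambda>g. F g + G g)"
| polyfun_mult: "polyfun n F \<Longrightarrow> polyfun n G \<Longrightarrow> polyfun n (\<lambda>g. F g * G g)"

lemma polyfun_sum: "(\<And>x. x \<in> A \<Longrightarrow> polyfun n (F x)) \<Longrightarrow> polyfun n (\<lambda>g. \<Sum>x\<in>A. F x g)"
  by (induction A rule: infinite_finite_induct) (auto intro: polyfun_const polyfun_add)

lemma polyfun_prod: "(\<And>x. x \<in> A \<Longrightarrow> polyfun n (F x)) \<Longrightarrow> polyfun n (\<lambda>g. \<Prod>x\<in>A. F x g)"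
  by (induction A rule: infinite_finite_induct) (auto intro: polyfun_const polyfun_mult)

text \<open>Leibniz expansion, in which the signs are constants.\<close>

lemma polyfun_det:
  assumes "\<And>i j. i < r \<Longrightarrow> j < r \<Longrightarrow> polyfun n (F i j)"
  shows "polyfun n (\<lambda>g. det (mat r r (\<lambda>(i, j). F i j g)))"
proof -
  have "det (mat r r (\<lambda>(i, j). F i j g)) =
      (\<Sum>p\<in>{p. p permutes {0..<r}}. signof p * (\<Prod>i = 0..<r. F i (p i) g))" for g
    by (auto simp: det_def permutes_in_image intro!: sum.cong prod.cong)
  moreover have "polyfun n (\<lambda>g. \<Sum>p\<in>{p. p permutes {0..<r}}. signof p * (\<Prod>i = 0..<r. F i (p i) g))"
    using assms by (auto intro!: polyfun_sum polyfun_mult polyfun_const polyfun_prod simp: permutes_in_image)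
  ultimately show ?thesis by simp
qed

text \<open>The bridge to \<open>zariski_open_GL\<close>, which asks for actual polynomials whose
  variables are index pairs.\<close>

lemma polyfun_eval_entries:
  assumes "polyfun n F"
  obtains p where "\<And>m. m \<in> Poly_Mapping.keys p \<Longrightarrow> Poly_Mapping.keys m \<subseteq> {..<n} \<times> {..<n}"
    "\<And>g. eval_entries g p = F g"
proof -
  have "\<exists>p. (\<forall>m\<in>Poly_Mapping.keys p. Poly_Mapping.keys m \<subseteq> {..<n} \<times> {..<n}) \<and> (\<forall>g. eval_entries g p = F g)"
    using assms
  proof induction
    case (polyfun_const c)
    show ?case
      by (rule exI[of _ "const c"]) (auto simp: eval_entries_eq_poly_eval ident.eval_single)
  next
    case (polyfun_entry i j)
    then show ?case
      by (intro exI[of _ "Poly_Mapping.single (Poly_Mapping.single (i, j) 1) 1"])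
         (auto simp: eval_entries_eq_poly_eval ident.eval_single)
  next
    case (polyfun_add F G)
    then obtain p q where pq:
      "\<forall>m\<in>Poly_Mapping.keys p. Poly_Mapping.keys m \<subseteq> {..<n} \<times> {..<n}" "\<forall>g. eval_entries g p = F g"
      "\<forall>m\<in>Poly_Mapping.keys q. Poly_Mapping.keys m \<subseteq> {..<n} \<times> {..<n}" "\<forall>g. eval_entries g q = G g"
      by blast
    have "Poly_Mapping.keys m \<subseteq> {..<n} \<times> {..<n}" if "m \<in> Poly_Mapping.keys (p + q)" for m
      using that Poly_Mapping.keys_add[of p q] pq by blast
    then show ?case
      using pq by (intro exI[of _ "p + q"]) (auto simp: eval_entries_eq_poly_eval ident.eval_add)
  next
    case (polyfun_mult F G)
    then obtain p q where pq:
      "\<forall>m\<in>Poly_Mapping.keys p. Poly_Mapping.keys m \<subseteq> {..<n} \<times> {..<n}" "\<forall>g. eval_entries g p = F g"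
      "\<forall>m\<in>Poly_Mapping.keys q. Poly_Mapping.keys m \<subseteq> {..<n} \<times> {..<n}" "\<forall>g. eval_entries g q = G g"
      by blast
    have "Poly_Mapping.keys m \<subseteq> {..<n} \<times> {..<n}" if "m \<in> Poly_Mapping.keys (p * q)" for m
    proof -
      obtain a b where "m = a + b" "a \<in> Poly_Mapping.keys p" "b \<in> Poly_Mapping.keys q"
        using keys_mult[of p q] \<open>m \<in> Poly_Mapping.keys (p * q)\<close> by blast
      then show ?thesis
        using Poly_Mapping.keys_add[of a b] pq by blast
    qed
    then show ?case
      using pq by (intro exI[of _ "p * q"]) (auto simp: eval_entries_eq_poly_eval ident.eval_mult)
  qed
  with that show thesis by blast
qed

lemma polyfun_on_line:
  assumes "polyfun n F"
  shows "\<exists>r. \<forall>t. F (mat n n (\<lambda>ij. (1 - t) * g1 $$ ij + t * g2 $$ ij)) = poly r t"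
  using assms
proof induction
  case (polyfun_const c)
  show ?case by (intro exI[of _ "[:c:]"]) simp
next
  case (polyfun_entry i j)
  then show ?case
    by (intro exI[of _ "[:g1 $$ (i, j), g2 $$ (i, j) - g1 $$ (i, j):]"]) (simp add: algebra_simps)
next
  case (polyfun_add F G)
  then show ?case by (metis poly_add)
next
  case (polyfun_mult F G)
  then show ?case by (metis poly_mult)
qed

text \<open>Irreducibility of the matrix space, by restriction to the line through the two points.\<close>

lemma polyfun_common_nonzero:
  fixes F G :: "'a::field_char_0 mat \<Rightarrow> 'a"
  assumes "polyfun n F" "polyfun n G"
    and g: "g1 \<in> carrier_mat n n" "F g1 \<noteq> 0" "g2 \<in> carrier_mat n n" "G g2 \<noteq> 0"
  shows "\<exists>g\<in>carrier_mat n n. F g * G g \<noteq> 0"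
proof -
  define line where "line t = mat n n (\<lambda>ij. (1 - t) * g1 $$ ij + t * g2 $$ ij)" for t
  obtain r s where rs: "\<And>t. F (line t) = poly r t" "\<And>t. G (line t) = poly s t"
    unfolding line_def using polyfun_on_line[OF assms(1)] polyfun_on_line[OF assms(2)] by blast
  have "line 0 = g1" "line 1 = g2"
    using g by (auto simp: line_def)
  then have "poly r 0 \<noteq> 0" "poly s 1 \<noteq> 0"
    using rs[of 0] rs[of 1] g by auto
  \<comment> \<open>Neither restriction to the line is the zero polynomial, so the product has
    finitely many roots, while a field of characteristic 0 is infinite.\<close>
  then have "r * s \<noteq> 0" by auto
  then have "finite {t. poly (r * s) t = 0}"
    by (rule poly_roots_finite)
  then obtain t where "poly (r * s) t \<noteq> 0"
    using ex_new_if_finite[OF infinite_UNIV_char_0] by blast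
  then have "F (line t) * G (line t) \<noteq> 0" by (simp add: rs)
  then show ?thesis by (intro bexI[of _ "line t"]) (auto simp: line_def)
qed

lemma polyfun_prod_nonzero:
  fixes F :: "'i \<Rightarrow> 'a::field_char_0 mat \<Rightarrow> 'a"
  assumes "finite A" "\<And>x. x \<in> A \<Longrightarrow> polyfun n (F x)" "\<And>x. x \<in> A \<Longrightarrow> \<exists>g\<in>carrier_mat n n. F x g \<noteq> 0"
  shows "\<exists>g\<in>carrier_mat n n. (\<Prod>x\<in>A. F x g) \<noteq> 0"
  using assms
proof (induction A rule: finite_induct)
  case empty
  show ?case by (auto intro: exI[of _ "0\<^sub>m n n"])
next
  case (insert x A)
  then obtain g1 g2 where "g1 \<in> carrier_mat n n" "F x g1 \<noteq> 0"
    "g2 \<in> carrier_mat n n" "(\<Prod>x\<in>A. F x g2) \<noteq> 0"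
    by (metis insertCI)
  then have "\<exists>g\<in>carrier_mat n n. F x g * (\<Prod>x\<in>A. F x g) \<noteq> 0"
    using insert.prems by (intro polyfun_common_nonzero polyfun_prod) auto
  then show ?case using insert.hyps by simp
qed

text \<open>The support bound is uniform in \<open>g\<close>: each coefficient of a product is then
  a sum over a fixed finite index set, hence again a polynomial function.\<close>

definition polyfam :: "nat \<Rightarrow> ('a::comm_ring_1 mat \<Rightarrow> 'a mpoly) \<Rightarrow> bool" where
  "polyfam n F \<longleftrightarrow> (\<exists>A. finite A \<and> (\<forall>g. Poly_Mapping.keys (F g) \<subseteq> A)) \<and>
     (\<forall>m. polyfun n (\<lambda>g. Poly_Mapping.lookup (F g) m))"

lemma polyfam_single: "polyfun n c \<Longrightarrow> polyfam n (\<lambda>g. Poly_Mapping.single m (c g))"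
  unfolding polyfam_def
proof (intro conjI allI)
  assume c: "polyfun n c"
  show "\<exists>A. finite A \<and> (\<forall>g. Poly_Mapping.keys (Poly_Mapping.single m (c g)) \<subseteq> A)"
    by (rule exI[of _ "{m}"]) auto
  show "polyfun n (\<lambda>g. Poly_Mapping.lookup (Poly_Mapping.single m (c g)) k)" for k
    using c by (cases "k = m") (auto simp: lookup_single intro: polyfun_const)
qed

lemma polyfam_add:
  assumes "polyfam n F" "polyfam n G"
  shows "polyfam n (\<lambda>g. F g + G g)"
proof -
  obtain A B where AB: "finite A" "\<And>g. Poly_Mapping.keys (F g) \<subseteq> A" "finite B" "\<And>g. Poly_Mapping.keys (G g) \<subseteq> B"
    using assms by (auto simp: polyfam_def)
  have "Poly_Mapping.keys (F g + G g) \<subseteq> A \<union> B" for g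
    using Poly_Mapping.keys_add[of "F g" "G g"] AB(2)[of g] AB(4)[of g] by blast
  moreover have "finite (A \<union> B)"
    using AB by simp
  moreover have "polyfun n (\<lambda>g. Poly_Mapping.lookup (F g + G g) m)" for m
    using assms by (simp add: polyfam_def lookup_add polyfun_add)
  ultimately show ?thesis
    unfolding polyfam_def by blast
qed

lemma lookup_mult_sum:
  fixes f h :: "'a::comm_ring_1 mpoly"
  assumes A: "finite A" "Poly_Mapping.keys f \<subseteq> A" and B: "finite B" "Poly_Mapping.keys h \<subseteq> B"
  shows "Poly_Mapping.lookup (f * h) m =
    (\<Sum>a\<in>A. \<Sum>b\<in>B. Poly_Mapping.lookup f a * Poly_Mapping.lookup h b * (if a + b = m then 1 else 0))"
proof -
  have "f * h = (\<Sum>a\<in>A. Poly_Mapping.single a (Poly_Mapping.lookup f a)) *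
      (\<Sum>b\<in>B. Poly_Mapping.single b (Poly_Mapping.lookup h b))"
    using sum_monomials[OF A] sum_monomials[OF B] by simp
  also have "\<dots> = (\<Sum>a\<in>A. \<Sum>b\<in>B. Poly_Mapping.single (a + b) (Poly_Mapping.lookup f a * Poly_Mapping.lookup h b))"
    by (simp add: sum_product mult_single)
  finally show ?thesis
    by (auto simp: lookup_sum lookup_single when_def intro!: sum.cong)
qed

lemma polyfam_mult:
  assumes "polyfam n F" "polyfam n G"
  shows "polyfam n (\<lambda>g. F g * G g)"
proof -
  obtain A B where AB: "finite A" "\<And>g. Poly_Mapping.keys (F g) \<subseteq> A" "finite B" "\<And>g. Poly_Mapping.keys (G g) \<subseteq> B"
    using assms by (auto simp: polyfam_def)
  have "finite ((\<lambda>(a, b). a + b) ` (A \<times> B))"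
    using AB by simp
  moreover have "Poly_Mapping.keys (F g * G g) \<subseteq> (\<lambda>(a, b). a + b) ` (A \<times> B)" for g
    using keys_mult[of "F g" "G g"] AB(2)[of g] AB(4)[of g] by fastforce
  moreover have "polyfun n (\<lambda>g. Poly_Mapping.lookup (F g * G g) m)" for m
    unfolding lookup_mult_sum[OF AB(1) AB(2) AB(3) AB(4)]
    using assms by (auto simp: polyfam_def intro!: polyfun_sum polyfun_mult polyfun_const)
  ultimately show ?thesis
    unfolding polyfam_def by blast
qed

lemma polyfam_const: "polyfam n (\<lambda>g. p)"
  by (auto simp: polyfam_def intro: polyfun_const finite_keys)

lemma polyfam_sum: "(\<And>x. x \<in> A \<Longrightarrow> polyfam n (F x)) \<Longrightarrow> polyfam n (\<lambda>g. \<Sum>x\<in>A. F x g)"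
  by (induction A rule: infinite_finite_induct) (auto intro: polyfam_const polyfam_add)

lemma polyfam_prod: "(\<And>x. x \<in> A \<Longrightarrow> polyfam n (F x)) \<Longrightarrow> polyfam n (\<lambda>g. \<Prod>x\<in>A. F x g)"
  by (induction A rule: infinite_finite_induct) (auto intro: polyfam_const polyfam_mult)

lemma polyfam_power: "polyfam n F \<Longrightarrow> polyfam n (\<lambda>g. F g ^ k)"
  by (induction k) (auto intro: polyfam_const polyfam_mult)

lemma polyfun_lookup_coord:
  assumes "f \<in> polys n"
  shows "polyfun n (\<lambda>g. Poly_Mapping.lookup (coord n g f) m)"
proof -
  have "polyfam n (\<lambda>g. lin_form n g i)" if "i < n" for i
    unfolding lin_form_def using that by (intro polyfam_sum polyfam_single polyfun_entry) auto
  \<comment> \<open>Only variables below \<open>n\<close> occur in \<open>f\<close>, so all entries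
    used lie inside the \<open>n\<close> by \<open>n\<close> matrix.\<close>
  moreover have "i < n" if "k \<in> Poly_Mapping.keys f" "i \<in> Poly_Mapping.keys k" for k i
    using assms that by (auto simp: polys_def monoms_def)
  ultimately have "polyfam n (\<lambda>g. coord n g f)"
    unfolding subst_def by (intro polyfam_sum polyfam_mult polyfam_const polyfam_prod polyfam_power) blast
  then show ?thesis by (simp add: polyfam_def)
qed

section \<open>Generic supports\<close>

text \<open>Inclusion in \<open>C\<close> rather than equality: vanishing of the coefficients
  outside \<open>C\<close> is a linear condition, which makes rank arguments possible.\<close>

definition supported :: "nat \<Rightarrow> 'a::comm_ring_1 mpoly set \<Rightarrow> (nat \<Rightarrow>\<^sub>0 nat) set \<Rightarrow> 'a mat \<Rightarrow> bool" where
  "supported n I C g \<longleftrightarrow> (\<exists>f\<in>act n g I. f \<noteq> 0 \<and> Poly_Mapping.keys f \<subseteq> C)"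

lemma keys_coord_upto:
  assumes "Poly_Mapping.keys f \<subseteq> monoms_upto n D"
  shows "Poly_Mapping.keys (coord n g f) \<subseteq> monoms_upto n D"
proof
  have f: "f \<in> polys n"
    using assms by (auto simp: polys_def monoms_upto_def)
  fix m assume m: "m \<in> Poly_Mapping.keys (coord n g f)"
  then have "hcomp (tdeg m) (coord n g f) \<noteq> 0"
    by (auto simp: hcomp_eq_0_iff)
  then have "hcomp (tdeg m) f \<noteq> 0"
    using hcomp_coord[OF f] by (auto simp: subst_zero)
  then obtain k where "k \<in> Poly_Mapping.keys f" "tdeg k = tdeg m"
    by (auto simp: hcomp_eq_0_iff)
  moreover have "m \<in> monoms n"
    using m coord_polys[OF f] by (auto simp: polys_def)
  ultimately show "m \<in> monoms_upto n D"
    using assms by (auto simp: monoms_upto_def)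
qed

text \<open>Through the inverse matrix, the elements to be substituted into form one space that is
  the same for every \<open>g\<close>.\<close>

lemma keys_coord_upto_iff:
  assumes g: "g \<in> GL n" and f: "f \<in> polys n"
  shows "Poly_Mapping.keys (coord n g f) \<subseteq> monoms_upto n D \<longleftrightarrow> Poly_Mapping.keys f \<subseteq> monoms_upto n D"
proof
  obtain h where "h \<in> carrier_mat n n" "g * h = 1\<^sub>m n"
    using g by (rule GL_inverse)
  then have "coord n h (coord n g f) = f"
    using g f by (intro coord_inverse) (auto simp: GL_def)
  then show "Poly_Mapping.keys f \<subseteq> monoms_upto n D" if "Poly_Mapping.keys (coord n g f) \<subseteq> monoms_upto n D"
    using keys_coord_upto[OF that, of h] by simp
qed (rule keys_coord_upto)

lemma linear_coeff_functional:
  assumes "Vector_Spaces.linear (\<lambda>c f. const c * f) (*) (\<lambda>f. l f :: 'a::field)" "finite A"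
  shows "l (\<Sum>m\<in>A. Poly_Mapping.single m (c m) :: 'a mpoly) = (\<Sum>m\<in>A. c m * l (Poly_Mapping.single m 1))"
proof -
  interpret l: Vector_Spaces.linear "\<lambda>c f. const c * f :: 'a mpoly" "(*)" l
    by fact
  have "(\<Sum>m\<in>A. Poly_Mapping.single m (c m)) = (\<Sum>m\<in>A. const (c m) * Poly_Mapping.single m (1::'a))"
    by (simp add: mult_single)
  then show ?thesis
    by (simp only: l.sum l.scale)
qed

text \<open>A left inverse at \<open>g0\<close> of the matrix of coefficients outside \<open>C\<close> yields a single
  determinant, equal to 1 at \<open>g0\<close>, whose non-vanishing excludes nonzero elements of \<open>g I\<close>
  supported in \<open>C\<close>.\<close>

lemma generic_not_supported:
  fixes I :: "'a::field mpoly set"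
  assumes I: "is_ideal n I" and g0: "g0 \<in> GL n" and C: "C \<subseteq> monoms_upto n D"
    and unsupp: "\<not> supported n I C g0"
  obtains F where "polyfun n F" "F g0 \<noteq> 0" "\<And>g. g \<in> GL n \<Longrightarrow> F g \<noteq> 0 \<Longrightarrow> \<not> supported n I C g"
proof -
  define T where "T = monoms_upto n D"
  \<comment> \<open>Finite-dimensional and independent of \<open>g\<close>; it contains the
    preimages of all elements of \<open>g(I)\<close> supported in \<open>C\<close>.\<close>
  define V where "V = I \<inter> {f. Poly_Mapping.keys f \<subseteq> T}"
  have finT: "finite T" by (simp add: T_def)
  have Ip: "I \<subseteq> polys n" using I by (simp add: is_ideal_def)
  have V: "mp.subspace V"
    unfolding V_def using I by (intro subspace_Int subspace_ideal subspace_keys)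
  obtain B where B: "B \<subseteq> V" "mp.independent B" "V \<subseteq> mp.span B"
    by (rule mp.basis_exists)
  have spB: "mp.span B = V"
    using B V mp.span_minimal by blast
  have "V \<subseteq> mp.span ((\<lambda>m. Poly_Mapping.single m 1) ` T)"
  proof
    fix f assume "f \<in> V"
    then have "f = (\<Sum>m\<in>T. Poly_Mapping.single m (Poly_Mapping.lookup f m))"
      by (intro sum_monomials finT) (simp add: V_def)
    also have "\<dots> = (\<Sum>m\<in>T. const (Poly_Mapping.lookup f m) * Poly_Mapping.single m 1)"
      by (simp add: mult_single)
    also have "\<dots> \<in> mp.span ((\<lambda>m. Poly_Mapping.single m 1) ` T)"
      by (intro mp.span_sum mp.span_scale mp.span_base) auto
    finally show "f \<in> mp.span ((\<lambda>m. Poly_Mapping.single m 1) ` T)" .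
  qed
  then have finB: "finite B"
    using mp.independent_span_bound[OF _ B(2)] finT B(1) by blast
  define r where "r = card B"
  obtain b where b: "bij_betw b {0..<r} B"
    unfolding r_def using ex_bij_betw_nat_finite[OF finB] by blast
  have bV: "b j \<in> V" if "j < r" for j
    using b that B(1) by (auto simp: bij_betw_def)
  \<comment> \<open>The part of the image under \<open>g0\<close> lying outside \<open>C\<close>. A
    nonzero kernel element in \<open>V\<close> would give a nonzero element of \<open>g0(I)\<close>
    supported in \<open>C\<close>, so this map is injective on \<open>V\<close>.\<close>
  define \<psi> where "\<psi> f = (\<Sum>m\<in>T - C. Poly_Mapping.single m (Poly_Mapping.lookup (coord n g0 f) m))" for f
  have lookup_\<psi>: "Poly_Mapping.lookup (\<psi> f) m =
      (if m \<in> T - C then Poly_Mapping.lookup (coord n g0 f) m else 0)" for f m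
    using finT by (simp add: \<psi>_def lookup_sum lookup_single when_def)
  have \<psi>: "Vector_Spaces.linear (\<lambda>c f. const c * f) (\<lambda>c f. const c * f) \<psi>"
    unfolding Vector_Spaces.linear_iff
    by (auto simp: mp.vector_space_axioms lookup_\<psi> lookup_add subst_add subst_mult subst_const intro!: poly_mapping_eqI)
  have "f = h" if fh: "f \<in> V" "h \<in> V" and eq: "\<psi> f = \<psi> h" for f h
  proof -
    define k where "k = f - h"
    have kV: "k \<in> V"
      unfolding k_def using fh V by (intro mp.subspace_diff)
    have "f = k + h" by (simp add: k_def)
    then have "coord n g0 f = coord n g0 k + coord n g0 h"
      by (simp add: subst_add)
    then have "Poly_Mapping.lookup (coord n g0 k) m = 0" if "m \<in> T - C" for m
      using arg_cong[OF eq, of "\<lambda>x. Poly_Mapping.lookup x m"] that by (simp add: lookup_\<psi> lookup_add)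
    moreover have "Poly_Mapping.keys (coord n g0 k) \<subseteq> T"
      using keys_coord_upto[of k n D g0] kV by (auto simp: V_def T_def)
    ultimately have "Poly_Mapping.keys (coord n g0 k) \<subseteq> C"
      by (auto simp: in_keys_iff)
    moreover have "coord n g0 k \<in> act n g0 I"
      using kV by (auto simp: V_def act_def)
    ultimately have "coord n g0 k = coord n g0 0"
      using unsupp by (auto simp: supported_def subst_zero)
    then have "k = 0"
      using inj_onD[OF coord_inj[OF g0], of k 0] kV Ip by (auto simp: V_def)
    then show "f = h" by (simp add: k_def)
  qed
  then have inj: "inj_on \<psi> V"
    by (rule inj_onI)
  interpret sc: vector_space_pair "\<lambda>c f. const c * f :: 'a mpoly" "(*) :: 'a \<Rightarrow> 'a \<Rightarrow> 'a"
    by unfold_locales (auto simp: algebra_simps)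
  have "mp.independent (\<psi> ` B)"
    using mp_pair.linear_independent_injective_image[OF \<psi> B(2)] inj spB by simp
  \<comment> \<open>Functionals dual to the images of the basis; they are the rows of the left
    inverse at \<open>g0\<close>.\<close>
  then have "\<exists>l. Vector_Spaces.linear (\<lambda>c f. const c * f) (*) l \<and>
      (\<forall>x\<in>\<psi> ` B. l x = (if x = \<psi> (b i) then 1 else 0))" for i
    by (rule sc.linear_independent_extend)
  then obtain l where l: "\<And>i. Vector_Spaces.linear (\<lambda>c f. const c * f) (*) (l i)"
    "\<And>i x. x \<in> \<psi> ` B \<Longrightarrow> l i x = (if x = \<psi> (b i) then 1 else 0)"
    by metis
  \<comment> \<open>The functionals stay fixed while \<open>g\<close> varies, so the entries are
    polynomial in \<open>g\<close>; at \<open>g0\<close> duality makes the matrix the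
    identity.\<close>
  define E where "E i j g = (\<Sum>m\<in>T - C. Poly_Mapping.lookup (coord n g (b j)) m * l i (Poly_Mapping.single m 1))" for i j g
  define F where "F g = det (mat r r (\<lambda>(i, j). E i j g))" for g
  have "polyfun n (E i j)" if "j < r" for i j
    unfolding E_def using bV[OF that] Ip
    by (intro polyfun_sum polyfun_mult polyfun_const polyfun_lookup_coord) (auto simp: V_def)
  then have "polyfun n F"
    unfolding F_def by (intro polyfun_det) auto
  moreover have "F g0 \<noteq> 0"
  proof -
    have "E i j g0 = (if i = j then 1 else 0)" if ij: "i < r" "j < r" for i j
    proof -
      have "E i j g0 = l i (\<psi> (b j))"
        unfolding E_def \<psi>_def using finT by (subst linear_coeff_functional[OF l(1)]) auto
      also have "\<dots> = (if \<psi> (b j) = \<psi> (b i) then 1 else 0)"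
        using b ij by (intro l(2)) (auto simp: bij_betw_def)
      also have "\<psi> (b j) = \<psi> (b i) \<longleftrightarrow> i = j"
        using inj_onD[OF inj, of "b j" "b i"] bV ij b by (auto simp: bij_betw_def inj_on_def)
      finally show ?thesis .
    qed
    then have "mat r r (\<lambda>(i, j). E i j g0) = 1\<^sub>m r"
      by (intro eq_matI) auto
    then show ?thesis by (simp add: F_def)
  qed
  moreover have "\<not> supported n I C g" if g: "g \<in> GL n" "F g \<noteq> 0" for g
  proof
    assume "supported n I C g"
    then obtain f where f: "f \<in> I" "coord n g f \<noteq> 0" "Poly_Mapping.keys (coord n g f) \<subseteq> C"
      by (auto simp: supported_def act_def)
    then have "f \<in> V"
      using keys_coord_upto_iff[OF g(1), of f D] C Ip by (auto simp: V_def T_def)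
    then obtain u where "f = (\<Sum>v\<in>B. const (u v) * v)"
      using spB mp.span_finite[OF finB] by blast
    also have "\<dots> = (\<Sum>j\<in>{0..<r}. const (u (b j)) * b j)"
      using b by (intro sum.reindex_bij_betw[symmetric])
    finally have f_sum: "f = (\<Sum>j\<in>{0..<r}. const (u (b j)) * b j)" .
    \<comment> \<open>The coordinates of \<open>f\<close> in the basis. Since the image of
      \<open>f\<close> vanishes outside \<open>C\<close>, they form a kernel vector of the matrix,
      which must be zero.\<close>
    define c where "c = vec r (\<lambda>j. u (b j))"
    have "(\<Sum>j\<in>{0..<r}. E i j g * u (b j)) = 0" for i
    proof -
      have lk: "Poly_Mapping.lookup (coord n g f) m =
          (\<Sum>j\<in>{0..<r}. u (b j) * Poly_Mapping.lookup (coord n g (b j)) m)" for m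
        unfolding f_sum by (simp add: subst_sum subst_mult subst_const lookup_sum)
      have "E i j g * u (b j) =
          (\<Sum>m\<in>T - C. u (b j) * Poly_Mapping.lookup (coord n g (b j)) m * l i (Poly_Mapping.single m 1))" for j
        unfolding E_def sum_distrib_right by (rule sum.cong[OF refl]) (simp only: mult_ac)
      then have "(\<Sum>j\<in>{0..<r}. E i j g * u (b j)) =
          (\<Sum>j\<in>{0..<r}. \<Sum>m\<in>T - C. u (b j) * Poly_Mapping.lookup (coord n g (b j)) m * l i (Poly_Mapping.single m 1))"
        by (simp only:)
      also have "\<dots> = (\<Sum>m\<in>T - C. \<Sum>j\<in>{0..<r}. u (b j) * Poly_Mapping.lookup (coord n g (b j)) m * l i (Poly_Mapping.single m 1))"
        by (rule sum.swap)
      also have "\<dots> = (\<Sum>m\<in>T - C. Poly_Mapping.lookup (coord n g f) m * l i (Poly_Mapping.single m 1))"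
        by (simp add: lk sum_distrib_right)
      also have "\<dots> = 0"
        using f(3) by (intro sum.neutral) (auto simp: in_keys_iff)
      finally show ?thesis .
    qed
    then have "mat r r (\<lambda>(i, j). E i j g) *\<^sub>v c = 0\<^sub>v r"
      by (intro eq_vecI) (auto simp: c_def scalar_prod_def)
    moreover have "c \<in> carrier_vec r"
      by (simp add: c_def)
    ultimately have "c = 0\<^sub>v r"
      using g(2) det_0_iff_vec_prod_zero_field[of "mat r r (\<lambda>(i, j). E i j g)" r]
      unfolding F_def by auto
    then have "u (b j) = 0" if "j < r" for j
    proof -
      have "u (b j) = c $ j" using that by (simp add: c_def)
      also have "\<dots> = 0" using \<open>c = 0\<^sub>v r\<close> that by simp
      finally show ?thesis .
    qed
    then have "f = 0"
      unfolding f_sum by (intro sum.neutral) auto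
    with f(2) show False by (simp add: subst_zero)
  qed
  ultimately show thesis by (rule that)
qed

text \<open>For each \<open>C\<close> either all \<open>g\<close> support it, and the constant 1
  serves, or it fails at some \<open>g0\<close> and a determinant excludes it generically. The sets
  \<open>C\<close> are finitely many, so the product of their polynomials defines
  \<open>U\<close>.\<close>

lemma generic_supports:
  fixes I :: "'a::field_char_0 mpoly set"
  assumes I: "is_ideal n I"
  obtains U where "zariski_open_GL n U" "U \<noteq> {}"
    "\<And>C g h. C \<subseteq> monoms_upto n D \<Longrightarrow> g \<in> U \<Longrightarrow> h \<in> U \<Longrightarrow> supported n I C g \<longleftrightarrow> supported n I C h"
proof -
  let ?T = "monoms_upto n D"
  have one: "(1\<^sub>m n :: 'a mat) \<in> GL n"
    by (simp add: GL_iff_det)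
  have "\<exists>F. polyfun n F \<and> (\<exists>g\<in>carrier_mat n n. F g \<noteq> 0) \<and>
      (\<forall>g\<in>GL n. \<forall>h\<in>GL n. F g \<noteq> 0 \<longrightarrow> F h \<noteq> 0 \<longrightarrow> supported n I C g = supported n I C h)"
    if C: "C \<subseteq> ?T" for C
  proof (cases "\<exists>g0\<in>GL n. \<not> supported n I C g0")
    case True
    then obtain g0 where g0: "g0 \<in> GL n" "\<not> supported n I C g0" by blast
    obtain F where "polyfun n F" "F g0 \<noteq> 0" "\<And>g. g \<in> GL n \<Longrightarrow> F g \<noteq> 0 \<Longrightarrow> \<not> supported n I C g"
      using generic_not_supported[OF I g0(1) C g0(2)] by blast
    with g0(1) show ?thesis
      by (intro exI[of _ F]) (auto simp: GL_def)
  next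
    case False
    with one show ?thesis
      by (intro exI[of _ "\<lambda>g. 1"]) (auto simp: polyfun_const GL_def)
  qed
  then have "\<forall>C\<in>Pow ?T. \<exists>F. polyfun n F \<and> (\<exists>g\<in>carrier_mat n n. F g \<noteq> 0) \<and>
      (\<forall>g\<in>GL n. \<forall>h\<in>GL n. F g \<noteq> 0 \<longrightarrow> F h \<noteq> 0 \<longrightarrow> supported n I C g = supported n I C h)"
    by simp
  from bchoice[OF this] obtain F where F0: "\<forall>C\<in>Pow ?T. polyfun n (F C) \<and>
      (\<exists>g\<in>carrier_mat n n. F C g \<noteq> 0) \<and> (\<forall>g\<in>GL n. \<forall>h\<in>GL n.
        F C g \<noteq> 0 \<longrightarrow> F C h \<noteq> 0 \<longrightarrow> supported n I C g = supported n I C h)" ..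
  have F: "polyfun n (F C)" "\<exists>g\<in>carrier_mat n n. F C g \<noteq> 0"
    "\<And>g h. g \<in> GL n \<Longrightarrow> h \<in> GL n \<Longrightarrow> F C g \<noteq> 0 \<Longrightarrow> F C h \<noteq> 0 \<Longrightarrow>
      supported n I C g = supported n I C h" if "C \<subseteq> ?T" for C
    using bspec[OF F0, of C] that by blast+
  define P where "P g = (\<Prod>C\<in>Pow ?T. F C g)" for g
  define U where "U = {g \<in> GL n. P g \<noteq> 0}"
  have P: "polyfun n P"
    unfolding P_def using F(1) by (intro polyfun_prod) auto
  obtain g1 where g1: "g1 \<in> carrier_mat n n" "P g1 \<noteq> 0"
    unfolding P_def using polyfun_prod_nonzero[of "Pow ?T" n F] F(1,2) by auto
  \<comment> \<open>A \<open>polyfun\<close> is a function on matrices of every shape, so the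
    determinant is expressed through entries below \<open>n\<close>. Multiplying by it moves the
    nonvanishing point into \<open>GL n\<close>.\<close>
  define dt where "dt g = det (mat n n (\<lambda>(i, j). g $$ (i, j)))" for g :: "'a mat"
  have dt: "dt g = det g" if "g \<in> carrier_mat n n" for g
    unfolding dt_def using that by (intro arg_cong[of _ _ det] eq_matI) auto
  have "polyfun n dt"
    unfolding dt_def by (intro polyfun_det polyfun_entry)
  then obtain g where "g \<in> carrier_mat n n" "P g * dt g \<noteq> 0"
    using polyfun_common_nonzero[OF P _ g1, of dt "1\<^sub>m n"] dt[of "1\<^sub>m n"] by auto
  then have "g \<in> U"
    using dt by (auto simp: U_def GL_iff_det)
  moreover have "zariski_open_GL n U"
  proof -
    obtain p where "\<And>m. m \<in> Poly_Mapping.keys p \<Longrightarrow> Poly_Mapping.keys m \<subseteq> {..<n} \<times> {..<n}"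
      "\<And>g. eval_entries g p = P g"
      by (rule polyfun_eval_entries[OF P]) (rule that)
    then show ?thesis
      unfolding zariski_open_GL_def U_def by (intro conjI exI[of _ "{p}"]) auto
  qed
  moreover have "supported n I C g = supported n I C h" if "C \<subseteq> ?T" "g \<in> U" "h \<in> U" for C g h
    using that F(3)[OF that(1)] by (auto simp: U_def P_def)
  ultimately show thesis using that by blast
qed

section \<open>Circuits form a universal Groebner basis\<close>

text \<open>For a subspace \<open>J\<close>, in the language of matroids: a minimal set of monomials
  that is linearly dependent modulo \<open>J\<close>.\<close>

definition circuit :: "'a::zero mpoly set \<Rightarrow> (nat \<Rightarrow>\<^sub>0 nat) set \<Rightarrow> bool" where
  "circuit J C \<longleftrightarrow> (\<exists>f\<in>J. f \<noteq> 0 \<and> Poly_Mapping.keys f = C) \<and>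
     (\<forall>h\<in>J. h \<noteq> 0 \<longrightarrow> \<not> Poly_Mapping.keys h \<subset> C)"

text \<open>Being a circuit is decided by \<open>supported\<close> on subsets of \<open>C\<close>,
  so it is constant in \<open>g\<close> wherever \<open>supported\<close> is.\<close>

lemma circuit_act_iff:
  "circuit (act n g I) C \<longleftrightarrow> supported n I C g \<and> (\<forall>C'. C' \<subset> C \<longrightarrow> \<not> supported n I C' g)"
proof
  assume C: "circuit (act n g I) C"
  then have "supported n I C g"
    by (auto simp: circuit_def supported_def)
  moreover have "\<not> supported n I C' g" if "C' \<subset> C" for C'
    using C that unfolding circuit_def supported_def by (meson subset_psubset_trans)
  ultimately show "supported n I C g \<and> (\<forall>C'. C' \<subset> C \<longrightarrow> \<not> supported n I C' g)"
    by blast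
next
  assume C: "supported n I C g \<and> (\<forall>C'. C' \<subset> C \<longrightarrow> \<not> supported n I C' g)"
  then have no: "\<not> Poly_Mapping.keys h \<subset> C" if "h \<in> act n g I" "h \<noteq> 0" for h
    using that unfolding supported_def by blast
  moreover obtain f where "f \<in> act n g I" "f \<noteq> 0" "Poly_Mapping.keys f \<subseteq> C"
    using C unfolding supported_def by blast
  ultimately show "circuit (act n g I) C"
    unfolding circuit_def by blast
qed

text \<open>Circuit elimination: a circuit avoiding \<open>m\<close> inside the support of \<open>f\<close> can be used to shrink
  that support while keeping \<open>m\<close>.\<close>

lemma circuit_through_monom:
  fixes J :: "'a::field mpoly set"
  assumes J: "is_ideal n J" and f: "f \<in> J" "m \<in> Poly_Mapping.keys f"
  obtains C where "circuit J C" "m \<in> C" "C \<subseteq> Poly_Mapping.keys f"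
proof -
  let ?P = "\<lambda>h. h \<in> J \<and> m \<in> Poly_Mapping.keys h \<and> Poly_Mapping.keys h \<subseteq> Poly_Mapping.keys f"
  have "?P f" using f by simp
  \<comment> \<open>The support is smallest only among elements containing \<open>m\<close>.
    Competitors \<open>h\<close> without \<open>m\<close> have to be ruled out by
    elimination.\<close>
  then obtain k where k: "?P k"
    "\<And>h. ?P h \<Longrightarrow> card (Poly_Mapping.keys k) \<le> card (Poly_Mapping.keys h)"
    using ex_has_least_nat[of ?P f "\<lambda>h. card (Poly_Mapping.keys h)"] by blast
  have "\<not> Poly_Mapping.keys h \<subset> Poly_Mapping.keys k" if h: "h \<in> J" "h \<noteq> 0" for h
  proof
    assume sub: "Poly_Mapping.keys h \<subset> Poly_Mapping.keys k"
    have "m \<notin> Poly_Mapping.keys h"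
    proof
      assume "m \<in> Poly_Mapping.keys h"
      with h sub k(1) have "card (Poly_Mapping.keys k) \<le> card (Poly_Mapping.keys h)"
        by (intro k(2)) auto
      with psubset_card_mono[OF finite_keys sub] show False by simp
    qed
    obtain x where x: "x \<in> Poly_Mapping.keys h"
      using h(2) by (metis all_not_in_conv keys_eq_empty)
    \<comment> \<open>Cancelling at \<open>x\<close> shrinks the support, and the coefficient of
      \<open>m\<close> is untouched because \<open>m\<close> does not occur in
      \<open>h\<close>.\<close>
    define q where "q = k - const (Poly_Mapping.lookup k x / Poly_Mapping.lookup h x) * h"
    have lq: "Poly_Mapping.lookup q y = Poly_Mapping.lookup k y -
        Poly_Mapping.lookup k x / Poly_Mapping.lookup h x * Poly_Mapping.lookup h y" for y
      by (simp add: q_def lookup_minus)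
    have "q \<in> J"
      unfolding q_def using J k(1) h(1) by (intro ideal_diff ideal_scale) auto
    have "x \<notin> Poly_Mapping.keys q"
      using x by (simp add: in_keys_iff lq)
    have "m \<in> Poly_Mapping.keys q"
      using k(1) \<open>m \<notin> Poly_Mapping.keys h\<close> by (simp add: in_keys_iff lq)
    have "Poly_Mapping.keys q \<subseteq> Poly_Mapping.keys k \<union> Poly_Mapping.keys h"
      by (auto simp: in_keys_iff lq)
    with sub x \<open>x \<notin> Poly_Mapping.keys q\<close> have "Poly_Mapping.keys q \<subset> Poly_Mapping.keys k"
      by blast
    then have "card (Poly_Mapping.keys q) < card (Poly_Mapping.keys k)"
      by (intro psubset_card_mono) auto
    moreover have "card (Poly_Mapping.keys k) \<le> card (Poly_Mapping.keys q)"
      using \<open>q \<in> J\<close> \<open>m \<in> Poly_Mapping.keys q\<close> \<open>Poly_Mapping.keys q \<subset> Poly_Mapping.keys k\<close> k(1)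
      by (intro k(2)) auto
    ultimately show False by simp
  qed
  moreover have "k \<noteq> 0"
    using k(1) by auto
  ultimately have "circuit J (Poly_Mapping.keys k)"
    using k(1) unfolding circuit_def by blast
  with k(1) that show thesis by blast
qed

section \<open>From leading monomials of circuits to generators of the ideal\<close>

lemma ideal_gen:
  fixes G :: "'a::comm_ring_1 mpoly set"
  assumes "finite G" "G \<subseteq> polys n"
  shows ideal_gen_ideal: "is_ideal n (ideal_gen n G)" and ideal_gen_superset: "G \<subseteq> ideal_gen n G"
proof -
  show "G \<subseteq> ideal_gen n G"
  proof
    fix h assume h: "h \<in> G"
    have "(\<Sum>k\<in>G. (if k = h then 1 else 0) * k) = (\<Sum>k\<in>G. if k = h then h else 0)"
      by (intro sum.cong) auto
    also have "\<dots> = h"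
      using assms(1) h by simp
    finally show "h \<in> ideal_gen n G"
      using polys_const[of 1 n] unfolding ideal_gen_def
      by (intro CollectI exI[of _ "\<lambda>k. if k = h then 1 else 0"]) auto
  qed
  have "x + y \<in> ideal_gen n G" if xy: "x \<in> ideal_gen n G" "y \<in> ideal_gen n G" for x y
  proof -
    obtain c d where cd: "\<And>h. h \<in> G \<Longrightarrow> c h \<in> polys n" "x = (\<Sum>h\<in>G. c h * h)"
      "\<And>h. h \<in> G \<Longrightarrow> d h \<in> polys n" "y = (\<Sum>h\<in>G. d h * h)"
      using xy by (auto simp: ideal_gen_def)
    then show ?thesis
      unfolding ideal_gen_def
      by (intro CollectI exI[of _ "\<lambda>h. c h + d h"]) (auto simp: sum.distrib algebra_simps intro: polys_add)
  qed
  moreover have "q * x \<in> ideal_gen n G" if x: "x \<in> ideal_gen n G" and q: "q \<in> polys n" for x q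
  proof -
    obtain c where "\<And>h. h \<in> G \<Longrightarrow> c h \<in> polys n" "x = (\<Sum>h\<in>G. c h * h)"
      using x by (auto simp: ideal_gen_def)
    then show ?thesis
      using q unfolding ideal_gen_def
      by (intro CollectI exI[of _ "\<lambda>h. q * c h"]) (auto simp: sum_distrib_left mult.assoc intro: polys_mult)
  qed
  moreover have "0 \<in> ideal_gen n G"
    unfolding ideal_gen_def by (intro CollectI exI[of _ "\<lambda>_. 0"]) auto
  moreover have "ideal_gen n G \<subseteq> polys n"
    using assms(2) by (auto simp: ideal_gen_def intro!: polys_sum polys_mult)
  ultimately show "is_ideal n (ideal_gen n G)"
    by (auto simp: is_ideal_def)
qed

text \<open>Supplies a concrete term order, through which generation of the ideal is deduced from
  leading monomials.\<close>

lemma term_order_lex: "term_order n (<)"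
proof -
  have "0 < a" if "a \<noteq> 0" for a :: "nat \<Rightarrow>\<^sub>0 nat"
  proof (rule ccontr)
    assume "\<not> 0 < a"
    with that have "a < 0" by simp
    then show False
      by (simp add: less_poly_mapping.rep_eq less_fun_def)
  qed
  then show ?thesis
    by (auto simp: term_order_def)
qed

text \<open>A generator \<open>m\<close> of the initial ideal of degree at most \<open>D\<close> is
  led by a homogeneous \<open>k\<close>. A circuit inside \<open>keys k\<close> through
  \<open>m\<close>, and so any element of \<open>G\<close> with that support, is homogeneous and
  again led by \<open>m\<close>.\<close>

lemma homogeneous_circuit_divisor:
  fixes J G :: "'a::field mpoly set"
  assumes J: "graded_ideal n J" and lt: "term_order n lt" and D: "generated_upto D (leads lt J)"
    and G: "\<And>C. C \<subseteq> monoms_upto n D \<Longrightarrow> circuit J C \<Longrightarrow> \<exists>h\<in>G. Poly_Mapping.keys h = C"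
    and f: "f \<in> J" "f \<noteq> 0"
  obtains h c where "h \<in> G" "h \<noteq> 0" "h \<in> homog n (tdeg (lead_monom lt h))"
    "lead_monom lt f = lead_monom lt h + c"
proof -
  have "lead_monom lt f \<in> leads lt J"
    using f by (auto simp: leads_def[OF lt])
  then obtain m c where m: "m \<in> leads lt J" "tdeg m \<le> D" "lead_monom lt f = m + c"
    using D unfolding generated_upto_def by blast
  define d where "d = tdeg m"
  have "m \<in> monoms n"
    using m(1) mono_ideal_leads[OF lt, of J] J by (auto simp: mono_ideal_def graded_ideal_def)
  then have "m \<in> leads lt (J \<inter> homog n d)"
    using m(1) leads_deg[OF lt J, of d] by (auto simp: monoms_deg_def d_def)
  then obtain k where k: "k \<in> J" "k \<in> homog n d" "k \<noteq> 0" "lead_monom lt k = m"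
    by (auto simp: leads_def[OF lt])
  have kp: "k \<in> polys n"
    using k(2) homog_polys by blast
  have "m \<in> Poly_Mapping.keys k"
    using lead_monom_in_keys[OF lt kp k(3)] k(4) by simp
  then obtain C where C: "circuit J C" "m \<in> C" "C \<subseteq> Poly_Mapping.keys k"
    using circuit_through_monom k(1) J unfolding graded_ideal_def by metis
  have "C \<subseteq> monoms_upto n D"
    using C(3) k(2) m(2) by (auto simp: homog_def monoms_deg_def monoms_upto_def d_def)
  then obtain h where h: "h \<in> G" "Poly_Mapping.keys h = C"
    using G C(1) by blast
  have lead: "lead_monom lt h = m"
    using lead_monom_subset[OF lt kp, of h] C h k(4) by simp
  show thesis
  proof (rule that[of h c])
    show "h \<noteq> 0" using h(2) C(2) by auto
    show "h \<in> homog n (tdeg (lead_monom lt h))"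
      using h(2) C(3) k(2) by (auto simp: lead homog_def d_def)
  qed (use h lead m(3) in auto)
qed

text \<open>\<open>groebner_basis\<close> speaks only of leading monomials, so the generation of
  \<open>J\<close> by \<open>G\<close> is a separate claim.\<close>

lemma universal_groebner_basis_circuits:
  fixes J G :: "'a::field mpoly set"
  assumes J: "graded_ideal n J" and D: "\<And>lt. term_order n lt \<Longrightarrow> generated_upto D (leads lt J)"
    and finG: "finite G" and GJ: "G \<subseteq> J"
    and G: "\<And>C. C \<subseteq> monoms_upto n D \<Longrightarrow> circuit J C \<Longrightarrow> \<exists>h\<in>G. Poly_Mapping.keys h = C"
  shows "universal_groebner_basis n J G"
proof -
  have idJ: "is_ideal n J" and Jp: "J \<subseteq> polys n"
    using J by (auto simp: graded_ideal_def is_ideal_def)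
  have "groebner_basis n lt J G" if lt: "term_order n lt" for lt
    unfolding groebner_basis_def
  proof (intro conjI ballI impI finG GJ)
    fix f assume "f \<in> J" "f \<noteq> 0"
    then show "\<exists>h\<in>G. h \<noteq> 0 \<and> (\<exists>c. lead_monom lt f = lead_monom lt h + c)"
      using homogeneous_circuit_divisor[OF J lt D[OF lt] G] by metis
  qed
  moreover have "ideal_gen n G = J"
  proof
    show "ideal_gen n G \<subseteq> J"
      using idJ GJ by (auto simp: ideal_gen_def is_ideal_def intro!: ideal_sum[OF idJ])
    have Gp: "G \<subseteq> polys n" using GJ Jp by blast
    note idG = ideal_gen_ideal[OF finG Gp] and GG = ideal_gen_superset[OF finG Gp]
    note lex = term_order_lex[of n]
    \<comment> \<open>Degree by degree only finitely many monomials occur, so elimination by leading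
      monomials applies.\<close>
    have eq: "J \<inter> homog n d = ideal_gen n G \<inter> homog n d" for d
    proof (rule subspace_eq_if_lead_monoms[OF lex finite_monoms_deg[of n d]])
      show "mp.subspace (J \<inter> homog n d)"
        using J by (rule subspace_ideal_homog)
      show "mp.subspace (ideal_gen n G \<inter> homog n d)"
        using idG by (intro subspace_Int subspace_ideal subspace_homog)
      show "ideal_gen n G \<inter> homog n d \<subseteq> J \<inter> homog n d"
        using \<open>ideal_gen n G \<subseteq> J\<close> by blast
      fix f assume f: "f \<in> J \<inter> homog n d" "f \<noteq> 0"
      then obtain h c where h: "h \<in> G" "h \<noteq> 0" "h \<in> homog n (tdeg (lead_monom (<) h))"
        "lead_monom (<) f = lead_monom (<) h + c"
        using homogeneous_circuit_divisor[OF J lex D[OF lex] G] by blast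
      have hp: "h \<in> polys n" and fp: "f \<in> polys n"
        using h(1) Gp f(1) Jp by auto
      have lf: "lead_monom (<) f \<in> monoms_deg n d"
        using lead_monom_in_keys[OF lex fp f(2)] f(1) by (auto simp: homog_def)
      then have c: "c \<in> monoms n" and d: "d = tdeg c + tdeg (lead_monom (<) h)"
        unfolding h(4) by (auto simp: monoms_deg_def monoms_add_iff tdeg_add)
      \<comment> \<open>Because \<open>h\<close> is homogeneous, its shift by \<open>c\<close> lies
        in degree \<open>d\<close>, and it has the leading monomial of \<open>f\<close>.\<close>
      have "Poly_Mapping.single c 1 * h \<in> ideal_gen n G"
        using idG GG h(1) polys_single[OF c, of 1] by (auto simp: is_ideal_def)
      moreover have "Poly_Mapping.single c (1::'a) \<in> homog n (tdeg c)"
        using c by (auto simp: homog_def monoms_deg_def)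
      then have "Poly_Mapping.single c 1 * h \<in> homog n d"
        unfolding d using h(3) by (rule homog_mult)
      moreover have "Poly_Mapping.single c 1 * h \<noteq> 0"
        using keys_single_mult[of 1 c h] h(2) by auto
      moreover have "lead_monom (<) (Poly_Mapping.single c 1 * h) = lead_monom (<) f"
        using lead_monom_single_mult[OF lex hp h(2) c] h(4) by simp
      ultimately show "\<exists>k\<in>ideal_gen n G \<inter> homog n d. k \<noteq> 0 \<and> lead_monom (<) k = lead_monom (<) f"
        by blast
    qed (auto simp: homog_def monoms_deg_def)
    show "J \<subseteq> ideal_gen n G"
    proof
      fix f assume f: "f \<in> J"
      have "hcomp d f \<in> ideal_gen n G" for d
      proof -
        have "hcomp d f \<in> J \<inter> homog n d"
          using f J Jp homog_hcomp by (auto simp: graded_ideal_def)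
        then show ?thesis unfolding eq by blast
      qed
      then have "(\<Sum>d\<in>tdeg ` Poly_Mapping.keys f. hcomp d f) \<in> ideal_gen n G"
        by (intro ideal_sum[OF idG])
      then show "f \<in> ideal_gen n G"
        using sum_hcomp[of f] by simp
    qed
  qed
  ultimately show ?thesis
    using finG by (simp add: universal_groebner_basis_def)
qed

theorem theorem3p1:
  fixes n :: nat and I :: "'a :: {alg_closed_field, field_char_0} mpoly set"
  assumes "graded_ideal n I"
  shows "\<exists>U. zariski_open_GL n U \<and> U \<noteq> {} \<and>
           (\<exists>S. \<forall>g\<in>U. \<exists>G. universal_groebner_basis n (act n g I) G \<and> supp_set G = S)"
proof -
  obtain D where D: "\<And>M. mono_ideal n M \<Longrightarrow>
      (\<And>d. card (M \<inter> monoms_deg n d) = mp.dim (I \<inter> homog n d)) \<Longrightarrow> generated_upto D M"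
    using hilbert_function_bound[of n "\<lambda>d. mp.dim (I \<inter> homog n d)"] by blast
  have "is_ideal n I"
    using assms by (simp add: graded_ideal_def)
  then obtain U where U: "zariski_open_GL n U" "U \<noteq> {}"
    "\<And>C g h. C \<subseteq> monoms_upto n D \<Longrightarrow> g \<in> U \<Longrightarrow> h \<in> U \<Longrightarrow> supported n I C g \<longleftrightarrow> supported n I C h"
    by (rule generic_supports[where D = D]) (rule that)
  from U(2) obtain g0 where g0: "g0 \<in> U" by blast
  \<comment> \<open>The circuits at one point of \<open>U\<close> serve as the common value.\<close>
  define S where "S = {C. C \<subseteq> monoms_upto n D \<and> circuit (act n g0 I) C}"
  have "\<exists>G. universal_groebner_basis n (act n g I) G \<and> supp_set G = S" if g: "g \<in> U" for g
  proof -
    have gGL: "g \<in> GL n"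
      using g U(1) by (auto simp: zariski_open_GL_def)
    have J: "graded_ideal n (act n g I)"
      using assms gGL by (rule graded_act)
    have S: "C \<in> S \<longleftrightarrow> C \<subseteq> monoms_upto n D \<and> circuit (act n g I) C" for C
    proof -
      \<comment> \<open>Minimality of \<open>C\<close> tests its subsets, and these stay within the
        degree bound for which \<open>U\<close> was built.\<close>
      have "supported n I C' g \<longleftrightarrow> supported n I C' g0" if "C' \<subseteq> C" "C \<subseteq> monoms_upto n D" for C'
        using U(3)[of C' g g0] that g g0 by blast
      then show ?thesis
        unfolding S_def circuit_act_iff by blast
    qed
    \<comment> \<open>Any element with the prescribed support will do, since only supports enter the
      argument.\<close>
    define pick where "pick C = (SOME f. f \<in> act n g I \<and> Poly_Mapping.keys f = C)" for C
    have pick: "pick C \<in> act n g I" "Poly_Mapping.keys (pick C) = C" if "C \<in> S" for C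
    proof -
      have "\<exists>f. f \<in> act n g I \<and> Poly_Mapping.keys f = C"
        using that by (auto simp: S circuit_def)
      from someI_ex[OF this] show "pick C \<in> act n g I" "Poly_Mapping.keys (pick C) = C"
        by (simp_all add: pick_def)
    qed
    have "S \<subseteq> Pow (monoms_upto n D)"
      by (auto simp: S_def)
    then have "finite S"
      by (rule finite_subset) simp
    have "universal_groebner_basis n (act n g I) (pick ` S)"
    proof (rule universal_groebner_basis_circuits[OF J])
      show "generated_upto D (leads lt (act n g I))" if lt: "term_order n lt" for lt
      proof (rule D)
        show "mono_ideal n (leads lt (act n g I))"
          using J by (intro mono_ideal_leads[OF lt]) (simp add: graded_ideal_def)
        show "card (leads lt (act n g I) \<inter> monoms_deg n d) = mp.dim (I \<inter> homog n d)" for d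
          \<comment> \<open>The first fact removes the dependence on the order, the second the
            dependence on \<open>g\<close>; hence one \<open>D\<close> for all.\<close>
          using card_leads_deg[OF lt J] dim_act_homog[OF assms gGL] by simp
      qed
    qed (use \<open>finite S\<close> pick S in auto)
    moreover have "supp_set (pick ` S) = S"
      using pick(2) by (simp add: supp_set_def supp_def image_image)
    ultimately show ?thesis by blast
  qed
  with U(1,2) show ?thesis by blast
qed

end
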